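(* Let $r\ge 1$ be an integer and let $f:[-1,1]\to\mathbb{R}$ be a function whose derivative $f^{(r-1)}$ is absolutely continuous on $[-1,1]$ and satisfies $f^{(r-1)}(t)=f^{(r-1)}(-1)+\int_{-1}^t g(y)\,dy$ for all $t\in[-1,1]$, for some absolutely integrable $g$ of bounded variation on $[-1,1]$. Let $V_r$ be the infimum of $\mathrm{Var}(g)$ over all such $g$. Suppose that for each $n$ points $-1\le x_n^{(n)}<\cdots<x_1^{(n)}\le 1$ are given and that this pointsystem is strongly normal with constant $c>0$. Then for every $n\ge r+1$ the interpolation error $E_n[f](x)=f(x)-\sum_{j=1}^n f(x_j^{(n)})\ell_j^{(n)}(x)$ satisfies $$\|E_n[f]\|_\infty\le \frac{\pi^r V_r}{\sqrt{c}\,(n-1)(n-2)\cdots(n-r)} .$$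
   Context: For the nodes $x_1^{(n)},\dots,x_n^{(n)}$ put $\omega_n(x)=\prod_{i=1}^n(x-x_i^{(n)})$, $\ell_k^{(n)}(x)=\frac{\omega_n(x)}{\omega_n'(x_k^{(n)})(x-x_k^{(n)})}$ (the Lagrange basis polynomials), and $v_k^{(n)}(t)=1-(t-x_k^{(n)})\frac{\omega_n''(x_k^{(n)})}{\omega_n'(x_k^{(n)})}$. The pointsystem is called strongly normal (with constant $c>0$) if $v_k^{(n)}(t)\ge c>0$ for all $n$, all $k=1,\dots,n$ and all $t\in[-1,1]$, where $c$ does not depend on $n,k,t$. $\|\cdot\|_\infty$ is the supremum norm on $[-1,1]$; $\mathrm{Var}(g)$ is the total variation of $g$ on $[-1,1]$; $f^{(0)}=f$. *)

theory Defs
  imports "HOL-Analysis.Analysis" "HOL-Computational_Algebra.Polynomial"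
begin

subsection \<open>Pointsystems and Lagrange interpolation\<close>

text \<open>A pointsystem is a map \<open>X :: nat \<Rightarrow> nat \<Rightarrow> real\<close>; \<open>X n k\<close> is the \<open>k\<close>-th node of the
  \<open>n\<close>-th row, for \<open>1 \<le> k \<le> n\<close>. The nodes of a row are numbered in decreasing order.
  Values at other indices are irrelevant.\<close>

definition pointsystem :: "(nat \<Rightarrow> nat \<Rightarrow> real) \<Rightarrow> bool" where
  "pointsystem X \<longleftrightarrow>
     (\<forall>n\<ge>1. -1 \<le> X n n \<and> (\<forall>k\<in>{1..<n}. X n (Suc k) < X n k) \<and> X n 1 \<le> 1)"

definition node_poly :: "(nat \<Rightarrow> nat \<Rightarrow> real) \<Rightarrow> nat \<Rightarrow> real poly" where
  "node_poly X n = (\<Prod>i=1..n. [:- X n i, 1:])"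

text \<open>The quotient \<open>\<omega>\<^sub>n(x) / (x - x\<^sub>k)\<close> is taken in the polynomial ring, where the division is
  exact, so that the value at \<open>x = x\<^sub>k\<close> is the right one (pointwise it would be \<open>0 / 0 = 0\<close>).\<close>

definition lagrange_basis :: "(nat \<Rightarrow> nat \<Rightarrow> real) \<Rightarrow> nat \<Rightarrow> nat \<Rightarrow> real poly" where
  "lagrange_basis X n k =
     smult (1 / poly (pderiv (node_poly X n)) (X n k)) (node_poly X n div [:- X n k, 1:])"

definition fejer_v :: "(nat \<Rightarrow> nat \<Rightarrow> real) \<Rightarrow> nat \<Rightarrow> nat \<Rightarrow> real \<Rightarrow> real" where
  "fejer_v X n k t =
     1 - (t - X n k) * (poly (pderiv (pderiv (node_poly X n))) (X n k)
                        / poly (pderiv (node_poly X n)) (X n k))"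

definition strongly_normal :: "(nat \<Rightarrow> nat \<Rightarrow> real) \<Rightarrow> real \<Rightarrow> bool" where
  "strongly_normal X c \<longleftrightarrow>
     c > 0 \<and> (\<forall>n\<ge>1. \<forall>k\<in>{1..n}. \<forall>t\<in>{-1..1}. fejer_v X n k t \<ge> c)"

definition interp_error ::
    "(nat \<Rightarrow> nat \<Rightarrow> real) \<Rightarrow> nat \<Rightarrow> (real \<Rightarrow> real) \<Rightarrow> real \<Rightarrow> real" where
  "interp_error X n f x = f x - (\<Sum>j=1..n. f (X n j) * poly (lagrange_basis X n j) x)"

text \<open>Extended-real valued, so that the norm of an unbounded function is \<open>\<infinity>\<close> rather than an
  unspecified real.\<close>

definition sup_norm :: "(real \<Rightarrow> real) \<Rightarrow> ereal" where
  "sup_norm h = (SUP t\<in>{-1..1}. ereal \<bar>h t\<bar>)"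

subsection \<open>Bounded variation and absolute continuity\<close>

definition variation_sums :: "(real \<Rightarrow> real) \<Rightarrow> real \<Rightarrow> real \<Rightarrow> real set" where
  "variation_sums g a b =
     {\<Sum>i<m. \<bar>g (p (Suc i)) - g (p i)\<bar> | (p :: nat \<Rightarrow> real) m.
        mono_on {..m} p \<and> p ` {..m} \<subseteq> {a..b}}"

definition bounded_variation :: "(real \<Rightarrow> real) \<Rightarrow> real \<Rightarrow> real \<Rightarrow> bool" where
  "bounded_variation g a b \<longleftrightarrow> bdd_above (variation_sums g a b)"

text \<open>Only meaningful for functions of bounded variation.\<close>

definition total_variation :: "(real \<Rightarrow> real) \<Rightarrow> real \<Rightarrow> real \<Rightarrow> real" where
  "total_variation g a b = Sup (variation_sums g a b)"

definition abs_continuous :: "(real \<Rightarrow> real) \<Rightarrow> real \<Rightarrow> real \<Rightarrow> bool" where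
  "abs_continuous h a b \<longleftrightarrow>
     (\<forall>e>0. \<exists>d>0. \<forall>(m :: nat) s t.
        (\<forall>i<m. a \<le> s i \<and> s i < t i \<and> t i \<le> b) \<longrightarrow>
        disjoint_family_on (\<lambda>i. {s i<..<t i}) {..<m} \<longrightarrow>
        (\<Sum>i<m. t i - s i) < d \<longrightarrow>
        (\<Sum>i<m. \<bar>h (t i) - h (s i)\<bar>) < e)"

definition bv_densities :: "(real \<Rightarrow> real) \<Rightarrow> (real \<Rightarrow> real) set" where
  "bv_densities h =
     {g. g absolutely_integrable_on {-1..1} \<and> bounded_variation g (-1) 1 \<and>
         (\<forall>t\<in>{-1..1}. h t = h (-1) + integral {-1..t} g)}"

definition min_density_variation :: "(real \<Rightarrow> real) \<Rightarrow> real" where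
  "min_density_variation h = (INF g\<in>bv_densities h. total_variation g (-1) 1)"

text \<open>\<open>D 0, \<dots>, D m\<close> are the derivatives of \<open>f\<close> of orders \<open>0, \<dots>, m\<close> on \<open>[-1, 1]\<close>,
  one-sided at the endpoints; they are determined by \<open>f\<close> on that interval.\<close>

definition derivatives_upto :: "nat \<Rightarrow> (real \<Rightarrow> real) \<Rightarrow> (nat \<Rightarrow> real \<Rightarrow> real) \<Rightarrow> bool" where
  "derivatives_upto m f D \<longleftrightarrow>
     (\<forall>t\<in>{-1..1}. D 0 t = f t) \<and>
     (\<forall>j<m. \<forall>t\<in>{-1..1}. (D j has_real_derivative D (Suc j) t) (at t within {-1..1}))"

end

theory Submission
  imports Defs
begin

text \<open>For fixed \<open>x\<close> the error functional annihilates polynomials of degree below \<open>n\<close>, so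
  \<open>E\<^sub>n[f](x) = \<integral> f' K\<^sub>0\<close> with \<open>K\<^sub>0\<close> the error of interpolating a step function. Integrating
  by parts with \<open>K\<^sub>s\<^sub>+\<^sub>1(u) = \<integral>\<^sub>u\<^sup>1 K\<^sub>s\<close> gives \<open>E\<^sub>n[f](x) = \<integral> g K\<^sub>r\<^sub>-\<^sub>1\<close>, which is at most
  \<open>Var(g) sup \<bar>K\<^sub>r\<bar>\<close> by the second mean value theorem.

  To the left of all nodes of an upper segment, the sum of their basis polynomials is dominated by a
  single one of them (and symmetrically on the right); strong normality and the Hermite--Fejer identity
  \<open>\<Sum> v\<^sub>k \<ell>\<^sub>k\<^sup>2 = 1\<close> bound each of them by \<open>1 / sqrt c\<close>, hence \<open>\<bar>K\<^sub>0\<bar> \<le> 1 / sqrt c\<close>.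

  Since \<open>K\<^sub>s\<close> is orthogonal to polynomials of degree \<open>n - 2 - s\<close>, a Bohr-type inequality gives
  \<open>sup \<bar>K\<^sub>s\<^sub>+\<^sub>1\<bar> \<le> \<pi> / (n - 1 - s) sup \<bar>K\<^sub>s\<bar>\<close>: after the substitution \<open>t = cos \<theta>\<close>, convolving with the
  Fejer--Korovkin kernel kills the odd periodic extension of \<open>K\<^sub>s\<^sub>+\<^sub>1(cos \<theta>)\<close>.\<close>

subsection \<open>Functions of bounded variation\<close>

lemma zero_in_variation_sums:
  assumes "a \<le> b"
  shows "0 \<in> variation_sums g a b"
  unfolding variation_sums_def
  by (intro CollectI exI[of _ "\<lambda>_. a"] exI[of _ "0::nat"]) (use assms in \<open>auto simp: mono_on_def\<close>)

lemma variation_sums_mono: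
  assumes "t \<le> b"
  shows "variation_sums g a t \<subseteq> variation_sums g a b"
  unfolding variation_sums_def using assms by fastforce

text \<open>Append \<open>s\<close> and \<open>t\<close> to the partition: this adds the increment
  from \<open>s\<close> to \<open>t\<close> and one nonnegative increment from the last partition
  point to \<open>s\<close>.\<close>

lemma variation_sums_extend:
  assumes "v \<in> variation_sums g a s" "a \<le> s" "s \<le> t"
  shows "\<exists>w\<in>variation_sums g a t. v + \<bar>g t - g s\<bar> \<le> w"
proof -
  obtain p :: "nat \<Rightarrow> real" and m where
    v: "v = (\<Sum>i<m. \<bar>g (p (Suc i)) - g (p i)\<bar>)" and p: "mono_on {..m} p" "p ` {..m} \<subseteq> {a..s}"
    using assms(1) unfolding variation_sums_def by blast
  define q where "q = (\<lambda>i. if i \<le> m then p i else if i = Suc m then s else t)"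
  have ps: "a \<le> p i \<and> p i \<le> s" if "i \<le> m" for i
    using p(2) that by auto
  have "(\<Sum>i<m. \<bar>g (q (Suc i)) - g (q i)\<bar>) = v"
    unfolding v q_def by (intro sum.cong) auto
  then have "v + \<bar>g t - g s\<bar> \<le> (\<Sum>i<Suc (Suc m). \<bar>g (q (Suc i)) - g (q i)\<bar>)"
    by (simp add: q_def)
  moreover have "mono_on {..Suc (Suc m)} q"
    using ps assms p(1) unfolding q_def mono_on_def by (auto intro: order_trans)
  moreover have "q ` {..Suc (Suc m)} \<subseteq> {a..t}"
  proof -
    have "a \<le> q i \<and> q i \<le> t" for i
      using ps[of i] assms unfolding q_def by auto
    then show ?thesis by auto
  qed
  ultimately show ?thesis
    unfolding variation_sums_def by blast
qed

text \<open>Jordan decomposition: with \<open>V t\<close> the variation on \<open>{a..t}\<close>,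
  the parts are \<open>(V + g) / 2\<close> and \<open>(V - g) / 2\<close>. Their increments add up
  to \<open>V b - V a\<close>, so splitting \<open>g\<close> loses no constant.\<close>

lemma bounded_variation_monotone_parts:
  fixes g :: "real \<Rightarrow> real"
  assumes bv: "bounded_variation g a b" and ab: "a \<le> b"
  obtains P N where "mono_on {a..b} P" "mono_on {a..b} N"
    "\<And>t. t \<in> {a..b} \<Longrightarrow> g t = P t - N t"
    "(P b - P a) + (N b - N a) \<le> total_variation g a b"
proof -
  define V where "V t = Sup (variation_sums g a t)" for t
  have bdd: "bdd_above (variation_sums g a t)" if "t \<le> b" for t
    by (rule bdd_above_mono[OF _ variation_sums_mono[OF that]]) (use bv in \<open>simp add: bounded_variation_def\<close>)
  have step: "V s + \<bar>g t - g s\<bar> \<le> V t" if st: "a \<le> s" "s \<le> t" "t \<le> b" for s t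
  proof -
    have "V s \<le> V t - \<bar>g t - g s\<bar>"
      unfolding V_def
    proof (rule cSup_least)
      show "variation_sums g a s \<noteq> {}"
        using zero_in_variation_sums[OF st(1)] by blast
      fix v assume "v \<in> variation_sums g a s"
      then obtain w where "w \<in> variation_sums g a t" "v + \<bar>g t - g s\<bar> \<le> w"
        using variation_sums_extend st by blast
      then show "v \<le> Sup (variation_sums g a t) - \<bar>g t - g s\<bar>"
        using cSup_upper[OF _ bdd[OF st(3)], of w] by linarith
    qed
    then show ?thesis by simp
  qed
  have V0: "V a \<ge> 0"
    unfolding V_def by (rule cSup_upper[OF zero_in_variation_sums bdd]) (use ab in auto)
  show thesis
  proof (rule that[of "\<lambda>t. (V t + g t) / 2" "\<lambda>t. (V t - g t) / 2"])
    show "mono_on {a..b} (\<lambda>t. (V t + g t) / 2)" "mono_on {a..b} (\<lambda>t. (V t - g t) / 2)"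
      using step by (force simp: mono_on_def)+
    show "(V b + g b) / 2 - (V a + g a) / 2 + ((V b - g b) / 2 - (V a - g a) / 2)
        \<le> total_variation g a b"
      using V0 by (simp add: total_variation_def V_def field_simps)
  qed (simp add: field_simps)
qed

section \<open>Boundedness and second mean value estimates for functions of bounded
  variation\<close>

lemma bounded_variation_imp_bounded:
  fixes g :: "real \<Rightarrow> real"
  assumes "bounded_variation g a b"
  shows "bounded (g ` {a..b})"
proof (cases "a \<le> b")
  case True
  obtain P N where PN: "mono_on {a..b} P" "mono_on {a..b} N"
    "\<And>t. t \<in> {a..b} \<Longrightarrow> g t = P t - N t"
    using bounded_variation_monotone_parts[OF assms True] by metis
  show ?thesis
  proof (rule boundedI[of _ "\<bar>P a\<bar> + \<bar>P b\<bar> + \<bar>N a\<bar> + \<bar>N b\<bar>"])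
    fix y assume "y \<in> g ` {a..b}"
    then obtain t where t: "t \<in> {a..b}" "y = g t" by blast
    have "P a \<le> P t" "P t \<le> P b" "N a \<le> N t" "N t \<le> N b"
      using t PN(1,2) by (auto simp: mono_on_def)
    then show "norm y \<le> \<bar>P a\<bar> + \<bar>P b\<bar> + \<bar>N a\<bar> + \<bar>N b\<bar>"
      using PN(3)[OF t(1)] t(2) by simp
  qed
qed simp

text \<open>The second mean value theorem gives \<open>P a\<close> times the integral up to some
  \<open>c\<close> plus \<open>P b\<close> times the integral from \<open>c\<close> on. Since
  \<open>h\<close> has integral 0, these collapse to \<open>P b - P a\<close> times the integral
  from \<open>c\<close> to \<open>b\<close>.\<close>

lemma integral_mult_mono_bound:
  fixes h P :: "real \<Rightarrow> real"
  assumes h: "h integrable_on {a..b}" and ab: "a \<le> b" and P: "mono_on {a..b} P"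
    and zero: "integral {a..b} h = 0"
    and M: "\<And>u. u \<in> {a..b} \<Longrightarrow> \<bar>integral {u..b} h\<bar> \<le> M"
  shows "(\<lambda>x. P x * h x) integrable_on {a..b}"
    and "\<bar>integral {a..b} (\<lambda>x. P x * h x)\<bar> \<le> M * (P b - P a)"
proof -
  obtain c where c: "c \<in> {a..b}" and
    I: "((\<lambda>x. P x * h x) has_integral P a * integral {a..c} h + P b * integral {c..b} h) {a..b}"
    using second_mean_value_theorem_full[OF h ab, of P] P by (auto simp: mono_on_def)
  show "(\<lambda>x. P x * h x) integrable_on {a..b}"
    using I by blast
  have "integral {a..c} h = - integral {c..b} h"
    using Henstock_Kurzweil_Integration.integral_combine[of a c b h] c h zero by auto
  then have "integral {a..b} (\<lambda>x. P x * h x) = (P b - P a) * integral {c..b} h"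
    using integral_unique[OF I] by (simp add: algebra_simps)
  moreover have "P a \<le> P b"
    using P ab by (auto simp: mono_on_def)
  ultimately show "\<bar>integral {a..b} (\<lambda>x. P x * h x)\<bar> \<le> M * (P b - P a)"
    using mult_right_mono[OF M[OF c], of "P b - P a"] by (simp add: abs_mult mult.commute)
qed

lemma integral_mult_bounded_variation_bound:
  fixes h g :: "real \<Rightarrow> real"
  assumes h: "h integrable_on {a..b}" and ab: "a \<le> b" and g: "bounded_variation g a b"
    and zero: "integral {a..b} h = 0"
    and M: "\<And>u. u \<in> {a..b} \<Longrightarrow> \<bar>integral {u..b} h\<bar> \<le> M"
  shows "\<bar>integral {a..b} (\<lambda>x. g x * h x)\<bar> \<le> M * total_variation g a b"
proof -
  obtain P N where PN: "mono_on {a..b} P" "mono_on {a..b} N"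
    "\<And>t. t \<in> {a..b} \<Longrightarrow> g t = P t - N t"
    "(P b - P a) + (N b - N a) \<le> total_variation g a b"
    using bounded_variation_monotone_parts[OF g ab] by metis
  note P = integral_mult_mono_bound[OF h ab PN(1) zero M]
  note N = integral_mult_mono_bound[OF h ab PN(2) zero M]
  have M0: "0 \<le> M"
    using M[of b] ab by simp
  have "integral {a..b} (\<lambda>x. g x * h x) = integral {a..b} (\<lambda>x. P x * h x - N x * h x)"
    by (rule integral_cong) (simp add: PN(3) left_diff_distrib)
  also have "\<dots> = integral {a..b} (\<lambda>x. P x * h x) - integral {a..b} (\<lambda>x. N x * h x)"
    by (rule integral_diff[OF P(1) N(1)])
  finally have "\<bar>integral {a..b} (\<lambda>x. g x * h x)\<bar> \<le> M * (P b - P a) + M * (N b - N a)"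
    using P(2) N(2) by linarith
  also have "\<dots> \<le> M * total_variation g a b"
    using mult_left_mono[OF PN(4) M0] by (simp add: distrib_left)
  finally show ?thesis .
qed

subsection \<open>Integration by parts for indefinite integrals\<close>

text \<open>A bounded gauge integrable function is absolutely integrable, and it stays so after
  multiplication by a bounded measurable factor.\<close>

lemma integrable_mult_bounded:
  fixes f g :: "real \<Rightarrow> real"
  assumes f: "f integrable_on {a..b}" "bounded (f ` {a..b})" and g: "g integrable_on {a..b}" "bounded (g ` {a..b})"
  shows "(\<lambda>x. f x * g x) integrable_on {a..b}"
proof -
  obtain B where B: "\<And>x. x \<in> {a..b} \<Longrightarrow> norm (g x) \<le> B"
    using g(2) unfolding bounded_iff by blast
  have "g absolutely_integrable_on {a..b}"
    using g(1) B by (rule_tac absolutely_integrable_integrable_bound[where g="\<lambda>_. B"]) auto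
  then have "(\<lambda>x. f x * g x) absolutely_integrable_on {a..b}"
    using f by (intro absolutely_integrable_bounded_measurable_product_real)
      (auto intro: integrable_imp_measurable)
  then show ?thesis
    by (simp add: absolutely_integrable_on_def)
qed

text \<open>An antiderivative of \<open>- h\<close> rather than of \<open>h\<close>, so that
  repeated integration by parts produces no signs. It vanishes at 1, and also at -1 when
  \<open>h\<close> has integral 0.\<close>

definition tail_integral :: "(real \<Rightarrow> real) \<Rightarrow> real \<Rightarrow> real" where
  "tail_integral h u = integral {u..1} h"

lemma tail_integral_diff:
  assumes "h integrable_on {-1..1}" "-1 \<le> u" "u \<le> v" "v \<le> 1"
  shows "tail_integral h u - tail_integral h v = integral {u..v} h"
proof -
  have "h integrable_on {u..1}"
    using assms by (auto intro: integrable_on_subinterval)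
  from Henstock_Kurzweil_Integration.integral_combine[OF assms(3,4) this]
  show ?thesis
    by (simp add: tail_integral_def)
qed

lemma abs_integral_le:
  fixes h :: "real \<Rightarrow> real"
  assumes "h integrable_on {a..b}" "a \<le> b" "\<And>t. t \<in> {a..b} \<Longrightarrow> \<bar>h t\<bar> \<le> M"
  shows "\<bar>integral {a..b} h\<bar> \<le> M * (b - a)"
  using integral_norm_bound_integral[of h "{a..b}" "\<lambda>_. M"] assms
  by (simp add: mult.commute integrable_const_ivl)

lemma tail_integral_lipschitz:
  assumes "h integrable_on {-1..1}" "\<And>t. t \<in> {-1..1} \<Longrightarrow> \<bar>h t\<bar> \<le> M"
    and "u \<in> {-1..1}" "v \<in> {-1..1}"
  shows "\<bar>tail_integral h u - tail_integral h v\<bar> \<le> M * \<bar>u - v\<bar>"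
proof -
  have *: "\<bar>tail_integral h u - tail_integral h v\<bar> \<le> M * \<bar>u - v\<bar>"
    if "-1 \<le> u" "u \<le> v" "v \<le> 1" for u v
  proof -
    have "h integrable_on {u..v}"
      using assms(1) that by (auto intro: integrable_on_subinterval)
    then show ?thesis
      using abs_integral_le[of h u v M] tail_integral_diff[OF assms(1) that] assms(2) that by auto
  qed
  show ?thesis
  proof (cases "u \<le> v")
    case True
    then show ?thesis using *[of u v] assms by auto
  next
    case False
    then show ?thesis using *[of v u] assms by (auto simp: abs_minus_commute)
  qed
qed

lemma lipschitz_abs_imp_continuous_on:
  fixes H :: "real \<Rightarrow> real"
  assumes "\<And>u v. u \<in> S \<Longrightarrow> v \<in> S \<Longrightarrow> \<bar>H u - H v\<bar> \<le> M * \<bar>u - v\<bar>"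
  shows "continuous_on S H"
proof (rule lipschitz_on_continuous_on)
  show "\<bar>M\<bar>-lipschitz_on S H"
  proof (rule lipschitz_onI)
    fix u v assume "u \<in> S" "v \<in> S"
    then have "\<bar>H u - H v\<bar> \<le> M * \<bar>u - v\<bar>" by (rule assms)
    also have "\<dots> \<le> \<bar>M\<bar> * \<bar>u - v\<bar>" by (rule mult_right_mono) auto
    finally show "dist (H u) (H v) \<le> \<bar>M\<bar> * dist u v" by (simp add: dist_real_def)
  qed simp
qed

text \<open>No continuity of \<open>h\<close> or \<open>g\<close> is available here, so the product rule is replaced by the estimate
  that the defect of the formula over \<open>[u, v]\<close> is \<open>O((v - u)\<^sup>2)\<close>.\<close>

lemma integral_by_parts_tail_integral:
  fixes h g F :: "real \<Rightarrow> real"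
  assumes h: "h integrable_on {-1..1}" "bounded (h ` {-1..1})"
    and g: "g integrable_on {-1..1}" "bounded (g ` {-1..1})"
    and F: "\<And>t. t \<in> {-1..1} \<Longrightarrow> F t = F (-1) + integral {-1..t} g"
    and zero: "integral {-1..1} h = 0"
  shows "integral {-1..1} (\<lambda>t. F t * h t) = integral {-1..1} (\<lambda>t. g t * tail_integral h t)"
proof -
  obtain A where A: "\<And>t. t \<in> {-1..1} \<Longrightarrow> \<bar>h t\<bar> \<le> A"
    using h(2) unfolding bounded_iff by force
  obtain B where B: "\<And>t. t \<in> {-1..1} \<Longrightarrow> \<bar>g t\<bar> \<le> B"
    using g(2) unfolding bounded_iff by force
  define H where "H = tail_integral h"
  have A0: "0 \<le> A" and B0: "0 \<le> B"
    using A[of 0] B[of 0] by auto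
  have FF: "F v - F u = integral {u..v} g" if "-1 \<le> u" "u \<le> v" "v \<le> 1" for u v
  proof -
    have "g integrable_on {-1..v}"
      using g(1) that by (auto intro: integrable_on_subinterval)
    from Henstock_Kurzweil_Integration.integral_combine[OF that(1,2) this] F[of u] F[of v] that
    show ?thesis by simp
  qed
  have HL: "\<bar>H u - H v\<bar> \<le> A * \<bar>u - v\<bar>" if "u \<in> {-1..1}" "v \<in> {-1..1}" for u v
    unfolding H_def by (rule tail_integral_lipschitz[OF h(1) A that])
  have FL: "\<bar>F v - F u\<bar> \<le> B * (v - u)" if "-1 \<le> u" "u \<le> v" "v \<le> 1" for u v
  proof -
    have "g integrable_on {u..v}"
      using g(1) that by (auto intro: integrable_on_subinterval)
    then show ?thesis
      using abs_integral_le[of g u v B] FF[OF that] B that by auto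
  qed
  have FL': "\<bar>F u - F v\<bar> \<le> B * \<bar>u - v\<bar>" if "u \<in> {-1..1}" "v \<in> {-1..1}" for u v
    using FL[of u v] FL[of v u] that by (cases "u \<le> v") (auto simp: abs_minus_commute)
  have Fc: "continuous_on {-1..1} F" and Hc: "continuous_on {-1..1} H"
    using lipschitz_abs_imp_continuous_on FL' HL by blast+
  have Fh: "(\<lambda>t. F t * h t) integrable_on {-1..1}" and gH: "(\<lambda>t. g t * H t) integrable_on {-1..1}"
    using h g integrable_continuous_real[OF Fc] integrable_continuous_real[OF Hc]
      compact_imp_bounded[OF compact_continuous_image[OF Fc compact_Icc]]
      compact_imp_bounded[OF compact_continuous_image[OF Hc compact_Icc]]
    by (simp_all add: integrable_mult_bounded)
  define q where "q = (\<lambda>t. F t * h t - g t * H t)"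
  have q: "q integrable_on {-1..1}"
    unfolding q_def by (rule integrable_diff[OF Fh gH])
  \<comment> \<open>The accumulated defect of the formula. Because \<open>H\<close> vanishes at both
    endpoints, constancy of \<open>E\<close> is the claim.\<close>
  define E where "E u = integral {-1..u} q + F u * H u" for u
  have est: "\<bar>E v - E u\<bar> \<le> 2 * A * B * (v - u)\<^sup>2" if uv: "-1 \<le> u" "u \<le> v" "v \<le> 1" for u v
  proof -
    have sub: "{u..v} \<subseteq> {-1..1}" using uv by auto
    have hi: "h integrable_on {u..v}" and gi: "g integrable_on {u..v}"
      and qi: "q integrable_on {u..v}" "q integrable_on {-1..v}"
      using h g q uv by (auto intro: integrable_on_subinterval)
    have "integral {-1..v} q - integral {-1..u} q = integral {u..v} q"
      using Henstock_Kurzweil_Integration.integral_combine[OF uv(1,2) qi(2)] by simp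
    \<comment> \<open>Freezing \<open>F\<close> at \<open>v\<close> and \<open>H\<close> at
      \<open>u\<close> makes this integral exactly \<open>F u * H u - F v * H v\<close>, so it
      cancels the boundary increment in \<open>E v - E u\<close>.\<close>
    moreover have "integral {u..v} (\<lambda>t. F v * h t - H u * g t)
        = F v * (H u - H v) - H u * (F v - F u)"
      using tail_integral_diff[OF h(1) uv] FF[OF uv] hi gi
      by (subst integral_diff) (auto simp: H_def intro: integrable_on_mult_right)
    ultimately have "E v - E u = integral {u..v} q - integral {u..v} (\<lambda>t. F v * h t - H u * g t)"
      by (simp add: E_def algebra_simps)
    also have "\<dots> = integral {u..v} (\<lambda>t. q t - (F v * h t - H u * g t))"
      using hi gi qi by (intro integral_diff[symmetric] integrable_diff integrable_on_mult_right)
    finally have eq: "E v - E u = integral {u..v} (\<lambda>t. q t - (F v * h t - H u * g t))" .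
    have "\<bar>q t - (F v * h t - H u * g t)\<bar> \<le> 2 * A * B * (v - u)" if t: "t \<in> {u..v}" for t
    proof -
      have t1: "t \<in> {-1..1}" using t sub by auto
      have "\<bar>F v - F t\<bar> \<le> B * (v - u)"
        using FL[of t v] t uv mult_left_mono[of "v - t" "v - u" B] B0 by auto
      moreover have "\<bar>H u - H t\<bar> \<le> A * (v - u)"
        using HL[of u t] t uv mult_left_mono[of "t - u" "v - u" A] A0 by auto
      ultimately have "\<bar>F v - F t\<bar> * \<bar>h t\<bar> \<le> B * (v - u) * A" "\<bar>g t\<bar> * \<bar>H u - H t\<bar> \<le> B * (A * (v - u))"
        using A[OF t1] B[OF t1] A0 B0 uv by (auto intro!: mult_mono)
      then have "\<bar>(F v - F t) * h t\<bar> \<le> A * B * (v - u)" "\<bar>(H u - H t) * g t\<bar> \<le> A * B * (v - u)"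
        by (simp_all add: abs_mult mult_ac)
      moreover have "q t - (F v * h t - H u * g t) = (H u - H t) * g t - (F v - F t) * h t"
        by (simp add: q_def algebra_simps)
      ultimately show ?thesis
        by linarith
    qed
    then have "\<bar>E v - E u\<bar> \<le> 2 * A * B * (v - u) * (v - u)"
      unfolding eq using hi gi qi uv
      by (intro abs_integral_le integrable_diff integrable_on_mult_right) auto
    then show ?thesis by (simp add: power2_eq_square mult.assoc)
  qed
  have "(E has_real_derivative 0) (at u within {-1..1})" if u: "u \<in> {-1..1}" for u
  proof -
    have "((\<lambda>v. (E v - E u) / (v - u)) \<longlongrightarrow> 0) (at u within {-1..1})"
    proof (rule Lim_null_comparison)
      have "\<bar>(E v - E u) / (v - u)\<bar> \<le> 2 * A * B * \<bar>v - u\<bar>" if "v \<in> {-1..1}" "v \<noteq> u" for v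
      proof -
        have "\<bar>E v - E u\<bar> \<le> 2 * A * B * \<bar>v - u\<bar>\<^sup>2"
          using est[of u v] est[of v u] u that
          by (cases "u \<le> v") (auto simp: abs_minus_commute power2_commute)
        then show ?thesis
          using that by (simp add: abs_divide divide_simps power2_eq_square mult.assoc)
      qed
      then show "\<forall>\<^sub>F v in at u within {-1..1}. norm ((E v - E u) / (v - u)) \<le> 2 * A * B * \<bar>v - u\<bar>"
        by (auto simp: eventually_at_filter)
      have "((\<lambda>v. 2 * A * B * \<bar>v - u\<bar>) \<longlongrightarrow> 2 * A * B * \<bar>u - u\<bar>) (at u within {-1..1})"
        by (intro tendsto_intros)
      then show "((\<lambda>v. 2 * A * B * \<bar>v - u\<bar>) \<longlongrightarrow> 0) (at u within {-1..1})" by simp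
    qed
    then show ?thesis by (simp add: has_field_derivative_iff)
  qed
  then have "E 1 = E (-1)"
    using has_field_derivative_zero_constant[of "{-1..1}" E] by fastforce
  moreover have "H (-1) = 0" "H 1 = 0"
    using zero by (auto simp: H_def tail_integral_def)
  ultimately have "integral {-1..1} q = 0"
    by (simp add: E_def)
  then show ?thesis
    using integral_diff[OF Fh gH] by (simp add: q_def H_def)
qed

subsection \<open>The Fejer--Korovkin kernel\<close>

lemma integral_cos_int:
  fixes l :: int
  shows "integral {-pi..pi} (\<lambda>s. cos (of_int l * s)) = (if l = 0 then 2 * pi else 0)"
proof (cases "l = 0")
  case False
  have "((\<lambda>s. cos (of_int l * s)) has_integral
      sin (of_int l * pi) / of_int l - sin (of_int l * (-pi)) / of_int l) {-pi..pi}"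
  proof (rule fundamental_theorem_of_calculus)
    fix s :: real
    have "((\<lambda>s. sin (of_int l * s) / of_int l) has_real_derivative cos (of_int l * s))
        (at s within {-pi..pi})"
      using False by (auto intro!: derivative_eq_intros)
    then show "((\<lambda>s. sin (of_int l * s) / of_int l) has_vector_derivative cos (of_int l * s))
        (at s within {-pi..pi})"
      by (rule has_real_derivative_iff_has_vector_derivative[THEN iffD1])
  qed simp
  then show ?thesis
    using False by (simp add: integral_unique mult.commute[of _ pi])
qed simp

text \<open>A sine vector vanishing at \<open>k = 0\<close> and \<open>k = N\<close>: the sum of the
  two neighbours of an entry is \<open>2 * cos (pi / N)\<close> times that entry. This makes the
  first cosine moment of the kernel equal to \<open>cos (pi / N)\<close> times its mass.\<close>

definition korovkin_coeff :: "nat \<Rightarrow> nat \<Rightarrow> real" where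
  "korovkin_coeff N k = sin (real k * (pi / real N))"

text \<open>The squared modulus of the exponential sum with coefficients
  \<open>korovkin_coeff N k\<close>, expanded into cosines; hence its nonnegativity.\<close>

definition korovkin_kernel :: "nat \<Rightarrow> real \<Rightarrow> real" where
  "korovkin_kernel N s =
     (\<Sum>j<N. \<Sum>k<N. korovkin_coeff N j * korovkin_coeff N k * cos (of_int (int j - int k) * s))"

definition korovkin_mass :: "nat \<Rightarrow> real" where
  "korovkin_mass N = 2 * pi * (\<Sum>k<N. (korovkin_coeff N k)\<^sup>2)"

lemma korovkin_coeff_0 [simp]: "korovkin_coeff N 0 = 0"
  and korovkin_coeff_self [simp]: "korovkin_coeff N N = 0"
  by (auto simp: korovkin_coeff_def)

lemma korovkin_kernel_nonneg: "korovkin_kernel N s \<ge> 0"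
proof -
  define a where "a = korovkin_coeff N"
  have "korovkin_kernel N s
      = (\<Sum>k<N. a k * cos (real k * s))\<^sup>2 + (\<Sum>k<N. a k * sin (real k * s))\<^sup>2"
    unfolding korovkin_kernel_def a_def
    by (simp add: power2_eq_square sum_product cos_diff left_diff_distrib sum.distrib[symmetric]
        algebra_simps)
  then show ?thesis by simp
qed

lemma continuous_on_korovkin_kernel [continuous_intros]:
  "continuous_on S (korovkin_kernel N)"
  unfolding korovkin_kernel_def by (intro continuous_intros)

lemma integral_double_sum:
  fixes f :: "nat \<Rightarrow> nat \<Rightarrow> real \<Rightarrow> real"
  assumes "\<And>j k. continuous_on {a..b} (f j k)"
  shows "integral {a..b} (\<lambda>s. \<Sum>j<N. \<Sum>k<N. c j k * f j k s)
    = (\<Sum>j<N. \<Sum>k<N. c j k * integral {a..b} (f j k))"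
proof -
  have "((\<lambda>s. \<Sum>j<N. \<Sum>k<N. c j k * f j k s) has_integral
      (\<Sum>j<N. \<Sum>k<N. c j k * integral {a..b} (f j k))) {a..b}"
    using assms by (intro has_integral_sum has_integral_mult_right integrable_integral
        integrable_continuous_interval) auto
  then show ?thesis by (rule integral_unique)
qed

lemma integral_korovkin_kernel:
  "integral {-pi..pi} (korovkin_kernel N) = korovkin_mass N"
proof -
  define a where "a = korovkin_coeff N"
  have "integral {-pi..pi} (korovkin_kernel N)
      = integral {-pi..pi} (\<lambda>s. \<Sum>j<N. \<Sum>k<N. a j * a k * cos (of_int (int j - int k) * s))"
    by (simp add: korovkin_kernel_def[abs_def] a_def)
  also have "\<dots> = (\<Sum>j<N. \<Sum>k<N. a j * a k * integral {-pi..pi} (\<lambda>s. cos (of_int (int j - int k) * s)))"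
    by (rule integral_double_sum) (intro continuous_intros)
  also have "\<dots> = (\<Sum>j<N. \<Sum>k<N. if j = k then a j * a k * (2 * pi) else 0)"
    by (intro sum.cong refl) (subst integral_cos_int, auto)
  also have "\<dots> = korovkin_mass N"
    by (simp add: korovkin_mass_def a_def sum_distrib_left power2_eq_square mult_ac)
  finally show ?thesis .
qed

text \<open>Multiply the neighbour relation by the entry itself and sum. The two shifted sums
  coincide because the coefficients vanish at 0 and \<open>N\<close>.\<close>

lemma korovkin_coeff_sum:
  assumes "N \<ge> 1"
  shows "2 * pi * (\<Sum>k<N. korovkin_coeff N k * korovkin_coeff N (Suc k))
       = cos (pi / real N) * korovkin_mass N"
proof -
  define a where "a = korovkin_coeff N"
  define t where "t = pi / real N"
  obtain n where n: "N = Suc n" using assms by (cases N) auto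
  have "2 * cos t * (\<Sum>k<N. (a k)\<^sup>2) = (\<Sum>k<N. a k * (2 * cos t * a k))"
    by (simp add: sum_distrib_left power2_eq_square mult_ac)
  \<comment> \<open>At \<open>k = 0\<close> the truncated \<open>k - 1\<close> is harmless, since
    \<open>a 0 = 0\<close>.\<close>
  also have "\<dots> = (\<Sum>k<N. a k * a (Suc k) + a k * a (k - 1))"
  proof (rule sum.cong[OF refl])
    fix k
    show "a k * (2 * cos t * a k) = a k * a (Suc k) + a k * a (k - 1)"
    proof (cases k)
      case (Suc j)
      have "sin (real k * t + t) + sin (real k * t - t) = 2 * cos t * sin (real k * t)"
        by (simp add: sin_add sin_diff)
      then have "2 * cos t * a k = a (Suc k) + a (k - 1)"
        by (simp add: a_def korovkin_coeff_def Suc t_def[symmetric] algebra_simps)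
      then show ?thesis by (simp add: distrib_left)
    qed (simp add: a_def)
  qed
  also have "\<dots> = (\<Sum>k<N. a k * a (Suc k)) + (\<Sum>k<N. a k * a (k - 1))"
    by (rule sum.distrib)
  also have "(\<Sum>k<N. a k * a (k - 1)) = (\<Sum>k<n. a k * a (Suc k))"
    unfolding n sum.lessThan_Suc_shift by (simp add: a_def mult.commute)
  also have "(\<Sum>k<n. a k * a (Suc k)) = (\<Sum>k<N. a k * a (Suc k))"
    using korovkin_coeff_self[of N] unfolding n by (simp add: a_def n)
  finally show ?thesis by (simp add: a_def korovkin_mass_def t_def)
qed

text \<open>Multiplying by \<open>cos s\<close> shifts each frequency by one up and down, so after
  integration only neighbouring index pairs survive, each with weight \<open>pi\<close>.\<close>

lemma integral_korovkin_kernel_cos: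
  assumes "N \<ge> 1"
  shows "integral {-pi..pi} (\<lambda>s. korovkin_kernel N s * cos s) = cos (pi / real N) * korovkin_mass N"
proof -
  define a where "a = korovkin_coeff N"
  have aN: "a N = 0"
    by (auto simp: a_def)
  have cc: "cos (of_int l * s) * cos s = (cos (of_int (l + 1) * s) + cos (of_int (l - 1) * s)) / 2"
    for l :: int and s :: real
    by (simp add: distrib_right left_diff_distrib cos_add cos_diff)
  have "korovkin_kernel N s * cos s = (\<Sum>j<N. \<Sum>k<N. a j * a k *
      ((cos (of_int (int j - int k + 1) * s) + cos (of_int (int j - int k - 1) * s)) / 2))" for s
    unfolding korovkin_kernel_def a_def sum_distrib_right mult.assoc cc ..
  then have "integral {-pi..pi} (\<lambda>s. korovkin_kernel N s * cos s)
      = integral {-pi..pi} (\<lambda>s. \<Sum>j<N. \<Sum>k<N. a j * a k *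
      ((cos (of_int (int j - int k + 1) * s) + cos (of_int (int j - int k - 1) * s)) / 2))"
    by simp
  also have "\<dots> = (\<Sum>j<N. \<Sum>k<N. a j * a k * integral {-pi..pi}
      (\<lambda>s. (cos (of_int (int j - int k + 1) * s) + cos (of_int (int j - int k - 1) * s)) / 2))"
    by (rule integral_double_sum) (intro continuous_intros, simp)
  also have "\<dots> = (\<Sum>j<N. \<Sum>k<N. (if k = Suc j then a j * a k * pi else 0)
      + (if j = Suc k then a j * a k * pi else 0))"
  proof (intro sum.cong refl)
    fix j k
    have "integral {-pi..pi}
        (\<lambda>s. (cos (of_int (int j - int k + 1) * s) + cos (of_int (int j - int k - 1) * s)) / 2)
      = (integral {-pi..pi} (\<lambda>s. cos (of_int (int j - int k + 1) * s))
        + integral {-pi..pi} (\<lambda>s. cos (of_int (int j - int k - 1) * s))) / 2"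
      unfolding integral_divide
      by (subst integral_add) (auto intro!: integrable_continuous_interval continuous_intros)
    also have "\<dots> = (if k = Suc j then pi else 0) + (if j = Suc k then pi else 0)"
      unfolding integral_cos_int by auto
    finally show "a j * a k * integral {-pi..pi}
        (\<lambda>s. (cos (of_int (int j - int k + 1) * s) + cos (of_int (int j - int k - 1) * s)) / 2)
      = (if k = Suc j then a j * a k * pi else 0) + (if j = Suc k then a j * a k * pi else 0)"
      by (simp only:) auto
  qed
  also have "\<dots> = (\<Sum>j<N. \<Sum>k<N. if k = Suc j then a j * a k * pi else 0)
      + (\<Sum>j<N. \<Sum>k<N. if k = Suc j then a k * a j * pi else 0)"
    unfolding sum.distrib by (subst (2) sum.swap) simp
  also have "\<dots> = 2 * pi * (\<Sum>k<N. a k * a (Suc k))"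
  proof -
    \<comment> \<open>For \<open>j = N - 1\<close> the index \<open>Suc j\<close> falls outside the
      range; the missing term carries the factor \<open>a N = 0\<close>.\<close>
    have "(\<Sum>k<N. if k = Suc j then a j * a k * pi else 0) = a j * a (Suc j) * pi"
      "(\<Sum>k<N. if k = Suc j then a k * a j * pi else 0) = a j * a (Suc j) * pi" if "j < N" for j
      using that aN by (cases "Suc j = N"; auto)+
    then show ?thesis by (simp add: sum_distrib_left sum.distrib[symmetric] mult_ac)
  qed
  also have "\<dots> = cos (pi / real N) * korovkin_mass N"
    using korovkin_coeff_sum[OF assms] by (simp add: a_def)
  finally show ?thesis .
qed

lemma korovkin_mass_pos:
  assumes "N \<ge> 2"
  shows "korovkin_mass N > 0"
proof -
  have "0 < sin (pi / real N)"
    using assms by (intro sin_gt_zero) (auto simp: field_simps)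
  then have "0 < (\<Sum>k\<in>{1}. (korovkin_coeff N k)\<^sup>2)"
    by (simp add: korovkin_coeff_def)
  also have "\<dots> \<le> (\<Sum>k<N. (korovkin_coeff N k)\<^sup>2)"
    using assms by (intro sum_mono2) auto
  finally show ?thesis by (simp add: korovkin_mass_def)
qed

text \<open>The right-hand side is chosen so that the kernel averages it to exactly \<open>\<tau>\<close>.\<close>

lemma abs_le_cos_majorant:
  assumes "0 < \<tau>" "\<tau> \<le> pi / 5" "\<bar>s\<bar> \<le> pi"
  shows "\<bar>s\<bar> \<le> \<tau> + (cos \<tau> - cos s) / sin \<tau>"
proof -
  have sin_pos: "0 < sin \<tau>"
    using assms pi_gt_zero by (intro sin_gt_zero) linarith+
  \<comment> \<open>This is \<open>sin \<tau>\<close> times the slack of the claim. On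
    \<open>{0..pi}\<close> it decreases up to \<tau>, increases up to \<open>pi - \<tau>\<close> and
    decreases again, so it suffices to look at \<open>g \<tau> = 0\<close> and
    \<open>g pi\<close>.\<close>
  define g where "g x = \<tau> * sin \<tau> + cos \<tau> - cos x - x * sin \<tau>" for x
  have der: "(g has_real_derivative sin x - sin \<tau>) (at x)" for x
    unfolding g_def by (auto intro!: derivative_eq_intros)
  \<comment> \<open>Together with \<open>\<tau> \<le> pi / 5\<close> this yields
    \<open>pi * \<tau> \<le> 2\<close>, which is what makes \<open>g pi\<close> nonnegative.\<close>
  have "pi\<^sup>2 \<le> 3.15\<^sup>2"
    using pi_approx by (intro power_mono) auto
  then have "pi * pi \<le> 10" by (simp add: power2_eq_square)
  then have "pi * \<tau> \<le> 2"
    using mult_left_mono[OF assms(2), of pi] pi_gt_zero by linarith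
  have g_pi: "0 \<le> g pi"
  proof -
    have "(pi - \<tau>) * sin \<tau> \<le> (pi - \<tau>) * \<tau>"
      using assms sin_x_le_x[of \<tau>] by (intro mult_left_mono) auto
    moreover have "1 - \<tau>\<^sup>2 / 2 \<le> cos \<tau>"
    proof -
      have "(sin (\<tau> / 2))\<^sup>2 \<le> (\<tau> / 2)\<^sup>2"
        using abs_sin_x_le_abs_x[of "\<tau> / 2"] unfolding abs_le_square_iff .
      then show ?thesis
        using cos_double_sin[of "\<tau> / 2"] by (simp add: power_divide)
    qed
    ultimately show ?thesis
      using \<open>pi * \<tau> \<le> 2\<close> zero_le_square[of \<tau>]
      unfolding g_def left_diff_distrib power2_eq_square cos_pi by linarith
  qed
  have g_nonneg: "0 \<le> g x" if x: "0 \<le> x" "x \<le> pi" for x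
  proof -
    consider "x \<le> \<tau>" | "\<tau> \<le> x" "x \<le> pi - \<tau>" | "pi - \<tau> \<le> x" by linarith
    then show ?thesis
    proof cases
      case 1
      have "sin y \<le> sin \<tau>" if "x \<le> y" "y \<le> \<tau>" for y
        using that x assms by (intro sin_monotone_2pi_le) auto
      then have "g \<tau> \<le> g x"
        using DERIV_nonpos_imp_nonincreasing[OF 1, of g] der by fastforce
      then show ?thesis by (simp add: g_def)
    next
      case 2
      have "sin \<tau> \<le> sin y" if y: "\<tau> \<le> y" "y \<le> x" for y
      proof (cases "y \<le> pi / 2")
        case True
        then show ?thesis using y assms by (intro sin_monotone_2pi_le) auto
      next
        case False
        then have "sin \<tau> \<le> sin (pi - y)" using y 2 assms by (intro sin_monotone_2pi_le) auto
        then show ?thesis by simp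
      qed
      then have "g \<tau> \<le> g x"
        using DERIV_nonneg_imp_nondecreasing[OF 2(1), of g] der by fastforce
      then show ?thesis by (simp add: g_def)
    next
      case 3
      have "sin y \<le> sin \<tau>" if "x \<le> y" "y \<le> pi" for y
      proof -
        have "sin (pi - y) \<le> sin \<tau>"
          using that 3 x assms by (intro sin_monotone_2pi_le) auto
        then show ?thesis by simp
      qed
      then have "g pi \<le> g x"
        using DERIV_nonpos_imp_nonincreasing[OF x(2), of g] der by fastforce
      then show ?thesis using g_pi by simp
    qed
  qed
  have "0 \<le> g \<bar>s\<bar>"
    using assms(3) by (intro g_nonneg) auto
  then show ?thesis
    using sin_pos by (simp add: g_def field_simps)
qed

text \<open>Integrate the cosine majorant against the nonnegative kernel: its second term
  contributes nothing because of the value of the first cosine moment.\<close>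

lemma integral_korovkin_kernel_abs:
  assumes "N \<ge> 5"
  shows "integral {-pi..pi} (\<lambda>s. korovkin_kernel N s * \<bar>s\<bar>) \<le> pi / N * korovkin_mass N"
proof -
  define \<tau> where "\<tau> = pi / N"
  have \<tau>: "0 < \<tau>" "\<tau> \<le> pi / 5"
    using assms by (auto simp: \<tau>_def field_simps)
  have sin_pos: "0 < sin \<tau>"
    using \<tau> pi_gt_zero by (intro sin_gt_zero) linarith+
  have "integral {-pi..pi} (\<lambda>s. korovkin_kernel N s * \<bar>s\<bar>)
      \<le> integral {-pi..pi} (\<lambda>s. korovkin_kernel N s * (\<tau> + (cos \<tau> - cos s) / sin \<tau>))"
    by (intro integral_le integrable_continuous_interval continuous_intros mult_left_mono
        abs_le_cos_majorant korovkin_kernel_nonneg \<tau>) (use sin_pos in auto)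
  also have "\<dots> = integral {-pi..pi} (\<lambda>s. (\<tau> + cos \<tau> / sin \<tau>) * korovkin_kernel N s
      - (1 / sin \<tau>) * (korovkin_kernel N s * cos s))"
    using sin_pos by (intro integral_cong) (simp add: field_simps)
  also have "\<dots> = (\<tau> + cos \<tau> / sin \<tau>) * integral {-pi..pi} (korovkin_kernel N)
      - (1 / sin \<tau>) * integral {-pi..pi} (\<lambda>s. korovkin_kernel N s * cos s)"
    by (subst integral_diff integral_mult_right; (intro integrable_continuous_interval continuous_intros)?)+ simp
  also have "\<dots> = \<tau> * korovkin_mass N"
    using integral_korovkin_kernel_cos[of N] assms
    by (simp add: integral_korovkin_kernel \<tau>_def[symmetric] distrib_right)
  finally show ?thesis by (simp add: \<tau>_def)
qed

subsection \<open>A Bohr-type inequality on the interval\<close>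

text \<open>The witnesses are the Chebyshev polynomials of the second kind, built by their
  three-term recurrence. They turn orthogonality to polynomials in \<open>cos \<theta>\<close> into
  orthogonality to sines.\<close>

lemma sin_multiple_poly:
  "\<exists>p::real poly. degree p \<le> k \<and> (\<forall>\<theta>. sin (real (Suc k) * \<theta>) = sin \<theta> * poly p (cos \<theta>))"
proof (induction k rule: induct_nat_012)
  case 0
  show ?case by (intro exI[of _ 1]) simp
next
  case 1
  have "sin (real (Suc (Suc 0)) * \<theta>) = sin \<theta> * poly [:0, 2:] (cos \<theta>)" for \<theta>
    using sin_double[of \<theta>] by (simp add: mult_ac)
  then show ?case
    by (intro exI[of _ "[:0, 2:]"]) simp
next
  case (ge2 k)
  then obtain p q :: "real poly" where p: "degree p \<le> k" "degree q \<le> Suc k"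
    and eq: "\<And>\<theta>. sin (real (Suc k) * \<theta>) = sin \<theta> * poly p (cos \<theta>)"
      "\<And>\<theta>. sin (real (Suc (Suc k)) * \<theta>) = sin \<theta> * poly q (cos \<theta>)"
    by blast
  have "sin (real (Suc (Suc (Suc k))) * \<theta>) = sin \<theta> * poly ([:0, 2:] * q - p) (cos \<theta>)" for \<theta>
  proof -
    define x where "x = real (Suc (Suc k)) * \<theta>"
    have "sin (x + \<theta>) + sin (x - \<theta>) = 2 * cos \<theta> * sin x"
      by (simp add: sin_add sin_diff)
    moreover have "x + \<theta> = real (Suc (Suc (Suc k))) * \<theta>" "x - \<theta> = real (Suc k) * \<theta>"
      by (simp_all add: x_def algebra_simps)
    ultimately show ?thesis
      using eq[of \<theta>] by (simp add: x_def algebra_simps)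
  qed
  moreover have "degree ([:0, 2:] * q - p) \<le> Suc (Suc k)"
    using p by (intro degree_diff_le order_trans[OF degree_mult_le]) auto
  ultimately show ?case by blast
qed

section \<open>Trigonometric and periodic integrals, and the odd periodic lift\<close>

lemma abs_cos_diff_le:
  fixes a b :: real
  shows "\<bar>cos a - cos b\<bar> \<le> \<bar>a - b\<bar>"
proof -
  have "\<bar>cos a - cos b\<bar> = 2 * (\<bar>sin ((a + b) / 2)\<bar> * \<bar>sin ((b - a) / 2)\<bar>)"
    by (simp add: cos_diff_cos abs_mult)
  also have "\<dots> \<le> 2 * (1 * \<bar>(b - a) / 2\<bar>)"
    by (intro mult_left_mono mult_mono abs_sin_le_one abs_sin_x_le_abs_x) auto
  finally show ?thesis by simp
qed

lemma integral_periodic_shift: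
  fixes w :: "real \<Rightarrow> real"
  assumes w: "continuous_on UNIV w" and per: "\<And>x. w (x + 2 * pi) = w x" and "0 \<le> \<phi>" "\<phi> \<le> 2 * pi"
  shows "integral {-pi..pi} (\<lambda>s. w (\<phi> + s)) = integral {-pi..pi} w"
proof -
  have c: "continuous_on S w" for S
    using w continuous_on_subset by blast
  have i: "w integrable_on {a..b}" for a b
    by (rule integrable_continuous_interval[OF c])
  have "integral {-pi..pi} (\<lambda>s. w (\<phi> + s)) = integral {-pi + \<phi>..pi + \<phi>} w"
    using integral_shift[of "-pi" \<phi> pi w] c by (simp add: o_def add.commute)
  also have "\<dots> = integral {-pi + \<phi>..pi} w + integral {pi..pi + \<phi>} w"
    using assms by (intro Henstock_Kurzweil_Integration.integral_combine[symmetric] i) auto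
  also have "integral {pi..pi + \<phi>} w = integral {-pi..-pi + \<phi>} w"
    using integral_shift[of "-pi" "2 * pi" "-pi + \<phi>" w] c per by (simp add: o_def add.commute)
  also have "integral {-pi + \<phi>..pi} w + integral {-pi..-pi + \<phi>} w = integral {-pi..pi} w"
    using Henstock_Kurzweil_Integration.integral_combine[of "-pi" "-pi + \<phi>" pi w] i assms by simp
  finally show ?thesis .
qed

lemma integral_odd_mult:
  fixes G f :: "real \<Rightarrow> real"
  assumes G: "continuous_on UNIV G" "\<And>x. G (- x) = - G x" and f: "continuous_on UNIV f" and "0 \<le> b"
  shows "integral {-b..b} (\<lambda>x. G x * f x) = integral {0..b} (\<lambda>x. G x * (f x - f (- x)))"
proof -
  have c: "continuous_on S (\<lambda>x. G x * f x)" for S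
    using continuous_on_mult[OF G(1) f] continuous_on_subset by blast
  have c': "continuous_on S (\<lambda>x. G x * f (- x))" for S
    using G(1) f continuous_on_subset
    by (intro continuous_intros continuous_on_compose2[OF f]) auto
  have "integral {-b..b} (\<lambda>x. G x * f x)
      = integral {-b..0} (\<lambda>x. G x * f x) + integral {0..b} (\<lambda>x. G x * f x)"
    using assms(4) c by (intro Henstock_Kurzweil_Integration.integral_combine[symmetric] integrable_continuous_interval) auto
  also have "integral {-b..0} (\<lambda>x. G x * f x) = integral {0..b} (\<lambda>x. - (G x * f (- x)))"
    using Henstock_Kurzweil_Integration.integral_reflect_real[of b 0 "\<lambda>x. G (- x) * f (- x)"] G(2) by simp
  also have "\<dots> + integral {0..b} (\<lambda>x. G x * f x)
      = integral {0..b} (\<lambda>x. - (G x * f (- x)) + G x * f x)"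
    by (intro integral_add[symmetric] integrable_continuous_interval c continuous_on_minus c')
  finally show ?thesis by (simp add: algebra_simps)
qed

lemma integral_cos_substitution:
  fixes f :: "real \<Rightarrow> real"
  assumes "continuous_on {-1..1} f"
  shows "integral {0..pi} (\<lambda>\<theta>. sin \<theta> * f (cos \<theta>)) = integral {-1..1} f"
proof -
  have "((\<lambda>\<theta>. - sin \<theta> *\<^sub>R f (cos \<theta>)) has_integral
      integral {cos 0..cos pi} f - integral {cos pi..cos 0} f) {0..pi}"
    by (rule has_integral_substitution_general[where c = "-1" and d = 1 and s = "{}"])
      (use assms in \<open>auto intro!: derivative_eq_intros continuous_intros\<close>)
  then have "((\<lambda>\<theta>. - (sin \<theta> * f (cos \<theta>))) has_integral - integral {-1..1} f) {0..pi}"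
    by simp
  from has_integral_neg[OF this] show ?thesis
    by (simp add: integral_unique)
qed

text \<open>The odd periodic extension of \<open>H \<circ> cos\<close> from \<open>{0..pi}\<close>.
  Since \<open>sgn 0 = 0\<close> it vanishes at multiples of \<open>pi\<close>, which matches
  \<open>H \<circ> cos\<close> there when \<open>H\<close> is zero at both endpoints.\<close>

definition odd_lift :: "(real \<Rightarrow> real) \<Rightarrow> real \<Rightarrow> real" where
  "odd_lift H \<theta> = sgn (sin \<theta>) * H (cos \<theta>)"

lemma odd_lift_minus: "odd_lift H (- \<theta>) = - odd_lift H \<theta>"
  by (simp add: odd_lift_def sgn_minus)

lemma odd_lift_periodic: "odd_lift H (\<theta> + 2 * pi) = odd_lift H \<theta>"
  by (simp add: odd_lift_def)

lemma odd_lift_eq: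
  assumes "H 1 = 0" "H (-1) = 0" "\<theta> \<in> {0..pi}"
  shows "odd_lift H \<theta> = H (cos \<theta>)"
proof (cases "\<theta> = 0 \<or> \<theta> = pi")
  case False
  then have "sin \<theta> > 0" using assms by (intro sin_gt_zero) auto
  then show ?thesis by (simp add: odd_lift_def)
qed (use assms in \<open>auto simp: odd_lift_def\<close>)

text \<open>If \<open>sin\<close> has the same sign at both points, use that \<open>cos\<close> is
  1-Lipschitz. Otherwise \<open>sin\<close> has a zero between them, the lift vanishes there, and
  the estimates on the two pieces add up.\<close>

lemma odd_lift_lipschitz:
  assumes H: "H 1 = 0" "H (-1) = 0"
    and L: "\<And>u v. u \<in> {-1..1} \<Longrightarrow> v \<in> {-1..1} \<Longrightarrow> \<bar>H u - H v\<bar> \<le> M * \<bar>u - v\<bar>"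
  shows "\<bar>odd_lift H a - odd_lift H b\<bar> \<le> M * \<bar>a - b\<bar>"
proof -
  have M0: "0 \<le> M"
    using L[of 0 1] abs_ge_zero[of "H 0 - H 1"] by simp
  have LH: "\<bar>H (cos x) - H (cos y)\<bar> \<le> M * \<bar>x - y\<bar>" for x y
    using L[of "cos x" "cos y"] mult_left_mono[OF abs_cos_diff_le[of x y] M0] by simp
  have zero: "\<bar>odd_lift H x\<bar> \<le> M * \<bar>x - z\<bar>" if "sin z = 0" for x z
  proof -
    have "cos z = 1 \<or> cos z = -1"
      using sin_cos_squared_add[of z] that by (simp add: power2_eq_1_iff)
    then have "H (cos z) = 0" using H by auto
    then have "\<bar>H (cos x)\<bar> \<le> M * \<bar>x - z\<bar>" using LH[of x z] by simp
    then show ?thesis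
      using M0 by (auto simp: odd_lift_def abs_mult sgn_if)
  qed
  have *: "\<bar>odd_lift H a - odd_lift H b\<bar> \<le> M * \<bar>a - b\<bar>" if "a \<le> b" for a b
  proof (cases "sgn (sin a) = sgn (sin b)")
    case True
    then have "\<bar>odd_lift H a - odd_lift H b\<bar> \<le> \<bar>H (cos a) - H (cos b)\<bar>"
      by (simp add: odd_lift_def right_diff_distrib[symmetric] abs_mult sgn_if split: if_splits)
    then show ?thesis using LH[of a b] by simp
  next
    case False
    have "\<exists>z\<ge>a. z \<le> b \<and> sin z = 0"
    proof (cases "sin a = 0")
      case nz: False
      then consider "sin a \<le> 0" "0 \<le> sin b" | "0 \<le> sin a" "sin b \<le> 0"
        using False by (auto simp: sgn_if split: if_splits)
      then show ?thesis
        using IVT'[of sin a 0 b] IVT2'[of sin b 0 a] that continuous_on_sin[OF continuous_on_id]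
        by cases auto
    qed (use that in auto)
    then obtain z where z: "a \<le> z" "z \<le> b" "sin z = 0" by blast
    have "\<bar>odd_lift H a - odd_lift H b\<bar> \<le> M * \<bar>a - z\<bar> + M * \<bar>b - z\<bar>"
      using zero[OF z(3), of a] zero[OF z(3), of b] by linarith
    also have "\<dots> = M * \<bar>a - b\<bar>" using z by (simp add: algebra_simps)
    finally show ?thesis .
  qed
  show ?thesis
    using *[of a b] *[of b a] by (cases "a \<le> b") (auto simp: abs_minus_commute)
qed

text \<open>The odd \<open>2\<pi>\<close>-periodic lift of \<open>H \<circ> cos\<close> is orthogonal to all trigonometric polynomials of degree
  at most \<open>m\<close>, so convolving it with a kernel of that degree gives zero.\<close>

lemma bohr_inequality_interval:
  fixes H :: "real \<Rightarrow> real"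
  assumes H: "H 1 = 0" "H (-1) = 0"
    and L: "\<And>u v. u \<in> {-1..1} \<Longrightarrow> v \<in> {-1..1} \<Longrightarrow> \<bar>H u - H v\<bar> \<le> M * \<bar>u - v\<bar>"
    and orth: "\<And>p. degree p < m \<Longrightarrow> integral {-1..1} (\<lambda>t. poly p t * H t) = 0"
    and m: "m \<ge> 3" and u: "u \<in> {-1..1}"
  shows "\<bar>H u\<bar> \<le> M * (pi / real (m + 2))"
proof -
  \<comment> \<open>As the coefficient of index 0 vanishes, only indices \<open>1..N - 1\<close>
    count and the kernel has degree at most \<open>N - 2 = m\<close>.\<close>
  define N where "N = m + 2"
  define G where "G = odd_lift H"
  define \<phi> where "\<phi> = arccos u"
  have \<phi>: "0 \<le> \<phi>" "\<phi> \<le> pi" "cos \<phi> = u"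
    using u by (auto simp: \<phi>_def arccos_lbound arccos_ubound)
  have GL: "\<bar>G a - G b\<bar> \<le> M * \<bar>a - b\<bar>" for a b
    unfolding G_def by (rule odd_lift_lipschitz[OF H L])
  have Gc: "continuous_on UNIV G"
    using GL by (rule lipschitz_abs_imp_continuous_on)
  have Gc': "continuous_on S G" for S
    using Gc continuous_on_subset by blast
  have Hc: "continuous_on {-1..1} H"
    using L by (rule lipschitz_abs_imp_continuous_on)
  \<comment> \<open>For \<open>l > 0\<close> the sine is \<open>sin \<theta>\<close> times a
    polynomial of degree at most \<open>l - 1 < m\<close> in \<open>cos \<theta>\<close>, and
    \<open>sin \<theta>\<close> is absorbed by the substitution.\<close>
  have sin_orth: "integral {0..pi} (\<lambda>\<theta>. G \<theta> * sin (real l * \<theta>)) = 0" if "l \<le> m" for l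
  proof (cases l)
    case (Suc k)
    obtain p :: "real poly" where p: "degree p \<le> k" "\<And>\<theta>. sin (real (Suc k) * \<theta>) = sin \<theta> * poly p (cos \<theta>)"
      using sin_multiple_poly[of k] by blast
    have "integral {0..pi} (\<lambda>\<theta>. G \<theta> * sin (real l * \<theta>))
        = integral {0..pi} (\<lambda>\<theta>. sin \<theta> * (poly p (cos \<theta>) * H (cos \<theta>)))"
      unfolding Suc p(2) by (rule integral_cong) (simp add: G_def odd_lift_eq[OF H])
    also have "\<dots> = integral {-1..1} (\<lambda>t. poly p t * H t)"
      by (rule integral_cos_substitution) (intro continuous_intros Hc)
    finally show ?thesis using orth[of p] p(1) that Suc by simp
  qed simp
  have conv0: "integral {-pi..pi} (\<lambda>s. cos (real l * s) * G (\<phi> + s)) = 0" if "l \<le> m" for l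
  proof -
    define w where "w \<theta> = G \<theta> * cos (real l * (\<theta> - \<phi>))" for \<theta>
    have "integral {-pi..pi} (\<lambda>s. cos (real l * s) * G (\<phi> + s)) = integral {-pi..pi} (\<lambda>s. w (\<phi> + s))"
      by (simp add: w_def mult.commute)
    also have "\<dots> = integral {-pi..pi} w"
    proof (rule integral_periodic_shift)
      show "continuous_on UNIV w"
        unfolding w_def by (intro continuous_intros Gc)
      fix x
      have "real l * (x + 2 * pi - \<phi>) = real l * (x - \<phi>) + 2 * real l * pi"
        by (simp add: algebra_simps)
      then have "cos (real l * (x + 2 * pi - \<phi>)) = cos (real l * (x - \<phi>))"
        using cos_2npi[of l] sin_2npi[of l] by (simp add: cos_add)
      then show "w (x + 2 * pi) = w x"
        by (simp add: w_def G_def odd_lift_periodic)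
    qed (use \<phi> in auto)
    \<comment> \<open>Since \<open>G\<close> is odd, only the odd part of the shifted cosine
      remains, and that is a multiple of \<open>sin (l * \<theta>)\<close>.\<close>
    also have "\<dots> = integral {0..pi} (\<lambda>\<theta>. G \<theta> * (cos (real l * (\<theta> - \<phi>)) - cos (real l * (- \<theta> - \<phi>))))"
      unfolding w_def
      by (rule integral_odd_mult[OF Gc]) (auto simp: G_def odd_lift_minus intro!: continuous_intros)
    also have "\<dots> = integral {0..pi} (\<lambda>\<theta>. (2 * sin (real l * \<phi>)) * (G \<theta> * sin (real l * \<theta>)))"
    proof (rule integral_cong)
      fix \<theta>
      have "cos (real l * (- \<theta> - \<phi>)) = cos (real l * \<theta> + real l * \<phi>)"
        by (subst cos_minus[symmetric]) (simp add: algebra_simps)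
      then show "G \<theta> * (cos (real l * (\<theta> - \<phi>)) - cos (real l * (- \<theta> - \<phi>)))
          = (2 * sin (real l * \<phi>)) * (G \<theta> * sin (real l * \<theta>))"
        by (simp add: right_diff_distrib[of "real l"] cos_diff cos_add algebra_simps)
    qed
    also have "\<dots> = 0"
      using sin_orth[OF that] by simp
    finally show ?thesis .
  qed
  have conv: "integral {-pi..pi} (\<lambda>s. korovkin_kernel N s * G (\<phi> + s)) = 0"
  proof -
    have Gc2: "continuous_on S (\<lambda>s. G (\<phi> + s))" for S
      by (intro continuous_on_compose2[OF Gc] continuous_intros) auto
    have term0: "korovkin_coeff N j * korovkin_coeff N k *
        integral {-pi..pi} (\<lambda>s. cos (of_int (int j - int k) * s) * G (\<phi> + s)) = 0"
      if "j < N" "k < N" for j k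
    proof (cases "j = 0 \<or> k = 0")
      case False
      define l where "l = nat \<bar>int j - int k\<bar>"
      have "l \<le> m" using that False by (auto simp: l_def N_def)
      moreover have "cos (of_int (int j - int k) * s) = cos (real l * s)" for s
      proof (cases "int j \<ge> int k")
        case False
        then have "real_of_int (int j - int k) * s = - (real l * s)" by (simp add: l_def algebra_simps)
        then show ?thesis by (simp only: cos_minus)
      qed (simp add: l_def)
      ultimately show ?thesis using conv0[of l] by simp
    qed auto
    have "korovkin_kernel N s * G (\<phi> + s) = (\<Sum>j<N. \<Sum>k<N. korovkin_coeff N j * korovkin_coeff N k *
        (cos (of_int (int j - int k) * s) * G (\<phi> + s)))" for s
      unfolding korovkin_kernel_def sum_distrib_right mult.assoc ..
    then have "integral {-pi..pi} (\<lambda>s. korovkin_kernel N s * G (\<phi> + s)) = (\<Sum>j<N. \<Sum>k<N. korovkin_coeff N j * korovkin_coeff N k *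
        integral {-pi..pi} (\<lambda>s. cos (of_int (int j - int k) * s) * G (\<phi> + s)))"
      by (simp only:) (rule integral_double_sum, intro continuous_intros Gc2)
    also have "\<dots> = 0"
      by (intro sum.neutral ballI term0) auto
    finally show ?thesis .
  qed
  have Gc2: "continuous_on S (\<lambda>s. G (\<phi> + s))" for S
    by (intro continuous_on_compose2[OF Gc] continuous_intros) auto
  \<comment> \<open>Subtracting the zero convolution leaves differences
    \<open>G \<phi> - G (\<phi> + s)\<close>, which the Lipschitz bound reduces to the first
    absolute moment of the kernel.\<close>
  have "korovkin_mass N * G \<phi> = integral {-pi..pi} (\<lambda>s. korovkin_kernel N s * G \<phi>)
      - integral {-pi..pi} (\<lambda>s. korovkin_kernel N s * G (\<phi> + s))"
    by (simp add: conv integral_korovkin_kernel)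
  also have "\<dots> = integral {-pi..pi} (\<lambda>s. korovkin_kernel N s * G \<phi> - korovkin_kernel N s * G (\<phi> + s))"
    by (intro integral_diff[symmetric] integrable_continuous_interval continuous_intros Gc2)
  finally have "\<bar>korovkin_mass N * G \<phi>\<bar> = norm (integral {-pi..pi} (\<lambda>s. korovkin_kernel N s * G \<phi> - korovkin_kernel N s * G (\<phi> + s)))"
    by simp
  also have "\<dots> \<le> integral {-pi..pi} (\<lambda>s. M * (korovkin_kernel N s * \<bar>s\<bar>))"
  proof (rule integral_norm_bound_integral)
    show "(\<lambda>s. korovkin_kernel N s * G \<phi> - korovkin_kernel N s * G (\<phi> + s)) integrable_on {-pi..pi}"
      by (intro integrable_continuous_interval continuous_intros Gc2)
    show "(\<lambda>s. M * (korovkin_kernel N s * \<bar>s\<bar>)) integrable_on {-pi..pi}"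
      by (intro integrable_continuous_interval continuous_intros)
    fix s
    show "norm (korovkin_kernel N s * G \<phi> - korovkin_kernel N s * G (\<phi> + s)) \<le> M * (korovkin_kernel N s * \<bar>s\<bar>)"
      using mult_left_mono[OF GL[of \<phi> "\<phi> + s"] korovkin_kernel_nonneg[of N s]] korovkin_kernel_nonneg[of N s]
      unfolding right_diff_distrib[symmetric] by (simp add: abs_mult mult_ac)
  qed
  also have "\<dots> \<le> M * (pi / real N * korovkin_mass N)"
  proof -
    have "0 \<le> M"
      using L[of 0 1] abs_ge_zero[of "H 0 - H 1"] by simp
    moreover have "N \<ge> 5"
      using m by (simp add: N_def)
    ultimately show ?thesis
      unfolding integral_mult_right by (intro mult_left_mono integral_korovkin_kernel_abs)
  qed
  finally have "korovkin_mass N * \<bar>G \<phi>\<bar> \<le> korovkin_mass N * (M * (pi / real N))"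
    using korovkin_mass_pos[of N] by (simp add: abs_mult N_def mult_ac)
  then have "\<bar>G \<phi>\<bar> \<le> M * (pi / real N)"
    using korovkin_mass_pos[of N] by (subst (asm) mult_le_cancel_left_pos) (simp_all add: N_def)
  moreover have "G \<phi> = H u"
    using odd_lift_eq[OF H, of \<phi>] \<phi> by (simp add: G_def)
  ultimately show ?thesis by (simp add: N_def)
qed

subsection \<open>Lagrange interpolation\<close>

text \<open>The product form over an arbitrary index set, so that nodes can be split into segments
  and reflected.\<close>

definition lagrange_poly :: "('i \<Rightarrow> real) \<Rightarrow> 'i set \<Rightarrow> 'i \<Rightarrow> real poly" where
  "lagrange_poly y I k = (\<Prod>i\<in>I - {k}. smult (1 / (y k - y i)) [:- y i, 1:])"

lemma poly_lagrange_poly: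
  "poly (lagrange_poly y I k) x = (\<Prod>i\<in>I - {k}. (x - y i) / (y k - y i))"
  by (simp add: lagrange_poly_def poly_prod diff_divide_distrib)

lemma poly_lagrange_poly_node:
  assumes "finite I" "inj_on y I" "j \<in> I" "k \<in> I"
  shows "poly (lagrange_poly y I k) (y j) = (if j = k then 1 else 0)"
proof (cases "j = k")
  case True
  have "(\<Prod>i\<in>I - {k}. (y k - y i) / (y k - y i)) = 1"
    using assms by (intro prod.neutral) (auto simp: inj_on_def)
  then show ?thesis using True by (simp add: poly_lagrange_poly)
next
  case False
  then show ?thesis using assms by (auto simp: poly_lagrange_poly intro!: prod_zero)
qed

lemma degree_lagrange_poly_less:
  assumes "finite I" "k \<in> I"
  shows "degree (lagrange_poly y I k) < card I"
proof -
  have "degree (lagrange_poly y I k) \<le> (\<Sum>i\<in>I - {k}. degree (smult (1 / (y k - y i)) [:- y i, 1:]))"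
    unfolding lagrange_poly_def
    using degree_prod_sum_le[of "I - {k}" "\<lambda>i. smult (1 / (y k - y i)) [:- y i, 1:]"] assms
    by (simp add: o_def)
  also have "\<dots> \<le> (\<Sum>i\<in>I - {k}. 1)"
    by (intro sum_mono) simp
  also have "\<dots> < card I"
    using card_Diff1_less[OF assms] by simp
  finally show ?thesis .
qed

lemma lagrange_interpolation_exact:
  assumes "finite I" "inj_on y I" "degree p < card I"
  shows "(\<Sum>k\<in>I. poly p (y k) * poly (lagrange_poly y I k) x) = poly p x"
proof -
  define q where "q = (\<Sum>k\<in>I. smult (poly p (y k)) (lagrange_poly y I k))"
  have "q = p"
  proof (rule poly_eqI_degree[where A = "y ` I"])
    have card: "card (y ` I) = card I" using assms by (simp add: card_image)
    have "degree q < card I"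
      unfolding q_def using assms degree_lagrange_poly_less
      by (intro degree_sum_less) (auto intro: le_less_trans[OF degree_smult_le])
    then show "degree q < card (y ` I)" "degree p < card (y ` I)"
      using assms card by auto
    fix z assume "z \<in> y ` I"
    then obtain j where j: "j \<in> I" "z = y j" by blast
    have "poly q z = (\<Sum>k\<in>I. if k = j then poly p (y k) else 0)"
      unfolding q_def poly_sum j(2)
      by (intro sum.cong refl) (simp add: poly_lagrange_poly_node[OF assms(1,2) j(1)])
    then show "poly q z = poly p z"
      using j assms by simp
  qed
  moreover have "poly q x = (\<Sum>k\<in>I. poly p (y k) * poly (lagrange_poly y I k) x)"
    by (simp add: q_def poly_sum)
  ultimately show ?thesis by simp
qed

text \<open>Split off the linear factor at \<open>X n k\<close>: the derivative there is the value
  of the cofactor, which is also the normalising constant of the product form.\<close>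

lemma pderiv_node_poly:
  assumes "inj_on (X n) {1..n}" "k \<in> {1..n}"
  shows "poly (pderiv (node_poly X n)) (X n k) \<noteq> 0"
    and "node_poly X n = smult (poly (pderiv (node_poly X n)) (X n k))
           ([:- X n k, 1:] * lagrange_poly (X n) {1..n} k)"
proof -
  define q where "q = (\<Prod>i\<in>{1..n} - {k}. [:- X n i, 1:])"
  have \<omega>: "node_poly X n = [:- X n k, 1:] * q"
    unfolding node_poly_def q_def using assms by (subst prod.remove[of _ k]) auto
  have d: "poly (pderiv (node_poly X n)) (X n k) = poly q (X n k)"
    unfolding \<omega> pderiv_mult by (simp add: pderiv_pCons)
  have q: "poly q (X n k) = (\<Prod>i\<in>{1..n} - {k}. X n k - X n i)"
    by (simp add: q_def poly_prod)
  have "X n k \<noteq> X n i" if "i \<in> {1..n} - {k}" for i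
    using inj_onD[OF assms(1), of k i] assms(2) that by blast
  then have qnz: "poly q (X n k) \<noteq> 0"
    by (simp add: q)
  then show nz: "poly (pderiv (node_poly X n)) (X n k) \<noteq> 0"
    by (simp add: d)
  have "lagrange_poly (X n) {1..n} k = smult (\<Prod>i\<in>{1..n} - {k}. 1 / (X n k - X n i)) q"
    unfolding lagrange_poly_def q_def prod_smult ..
  also have "(\<Prod>i\<in>{1..n} - {k}. 1 / (X n k - X n i)) = 1 / poly q (X n k)"
    unfolding q prod_dividef by simp
  finally have "lagrange_poly (X n) {1..n} k = smult (1 / poly q (X n k)) q" .
  then show "node_poly X n = smult (poly (pderiv (node_poly X n)) (X n k))
      ([:- X n k, 1:] * lagrange_poly (X n) {1..n} k)"
    unfolding d using qnz by (simp add: \<omega>)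
qed

lemma lagrange_basis_eq_lagrange_poly:
  assumes "inj_on (X n) {1..n}" "k \<in> {1..n}"
  shows "lagrange_basis X n k = lagrange_poly (X n) {1..n} k"
proof -
  define c where "c = poly (pderiv (node_poly X n)) (X n k)"
  have c: "c \<noteq> 0"
    using pderiv_node_poly(1)[of X n k, OF assms] by (simp add: c_def)
  have "node_poly X n = [:- X n k, 1:] * smult c (lagrange_poly (X n) {1..n} k)"
    by (subst pderiv_node_poly(2)[of X n k, OF assms]) (simp add: c_def)
  then have "node_poly X n div [:- X n k, 1:] = smult c (lagrange_poly (X n) {1..n} k)"
    by (simp only: nonzero_mult_div_cancel_left[of "[:- X n k, 1:]"] pCons_eq_0_iff
        one_neq_zero simp_thms)
  then show ?thesis
    using c by (simp add: lagrange_basis_def c_def[symmetric])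
qed

subsection \<open>Interpolation of a step function\<close>

text \<open>The polynomial that is 1 at the nodes \<open>A\<close> and 0 at the nodes \<open>B\<close>, divided by
  \<open>\<Prod>b\<in>B. (x - y b)\<close>.\<close>

definition step_quotient :: "('i \<Rightarrow> real) \<Rightarrow> 'i set \<Rightarrow> 'i set \<Rightarrow> real \<Rightarrow> real" where
  "step_quotient y A B x =
     (\<Sum>a\<in>A. (\<Prod>j\<in>A - {a}. (x - y j) / (y a - y j)) * (\<Prod>b\<in>B. 1 / (y a - y b)))"

text \<open>Neville's recurrence for the pair of nodes \<open>a\<close>, \<open>b\<close>.\<close>

lemma step_quotient_insert_insert:
  assumes fin: "finite A" "finite B" and new: "a \<notin> A" "b \<notin> B"
    and inj: "inj_on y (insert a A)" and less: "\<And>a'. a' \<in> insert a A \<Longrightarrow> y b < y a'"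
  shows "step_quotient y (insert a A) (insert b B) x
    = (step_quotient y (insert a A) B x + (y a - x) * step_quotient y A (insert b B) x) / (y a - y b)"
proof -
  define W where "W c = (\<Prod>j\<in>A - {c}. (x - y j) / (y c - y j)) * (\<Prod>b\<in>B. 1 / (y c - y b))" for c
  have ba: "y a - y b \<noteq> 0" using less[of a] by simp
  have W': "(\<Prod>j\<in>insert a A - {c}. (x - y j) / (y c - y j)) * (\<Prod>b\<in>B. 1 / (y c - y b))
      = (x - y a) / (y c - y a) * W c" if "c \<in> A" for c
  proof -
    have "insert a A - {c} = insert a (A - {c})" "a \<notin> A - {c}" using that new by auto
    then show ?thesis using fin by (simp add: W_def)
  qed
  have Wa: "insert a A - {a} = A - {a}" by auto
  have PB: "(\<Prod>b\<in>insert b B. 1 / (y c - y b)) = (\<Prod>b\<in>B. 1 / (y c - y b)) / (y c - y b)" for c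
    using fin new by simp
  have Q1: "step_quotient y (insert a A) (insert b B) x
      = W a / (y a - y b) + (\<Sum>c\<in>A. (x - y a) / (y c - y a) * W c / (y c - y b))"
    unfolding step_quotient_def PB sum.insert[OF fin(1) new(1)] Wa times_divide_eq_right
    by (intro arg_cong2[where f = "(+)"] sum.cong refl) (simp_all only: W' W_def[of a])
  have Q2: "step_quotient y (insert a A) B x = W a + (\<Sum>c\<in>A. (x - y a) / (y c - y a) * W c)"
    unfolding step_quotient_def sum.insert[OF fin(1) new(1)] Wa
    by (intro arg_cong2[where f = "(+)"] sum.cong refl) (simp_all only: W' W_def[of a])
  have Q3: "step_quotient y A (insert b B) x = (\<Sum>c\<in>A. W c / (y c - y b))"
    using fin new by (simp add: step_quotient_def W_def mult_ac)
  \<comment> \<open>Up to the factor \<open>(x - y a) * W c\<close> this is the partial fraction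
    decomposition of \<open>1 / ((y c - y a) * (y c - y b))\<close>.\<close>
  have "(x - y a) / (y c - y a) * W c / (y c - y b)
      = ((x - y a) / (y c - y a) * W c + (y a - x) * (W c / (y c - y b))) / (y a - y b)"
    if "c \<in> A" for c
  proof -
    have "y c - y a \<noteq> 0" using inj that new by (auto simp: inj_on_def)
    moreover have "y c - y b \<noteq> 0" using less[of c] that by auto
    ultimately show ?thesis using ba by (simp add: divide_simps) (simp add: algebra_simps)
  qed
  then have "(\<Sum>c\<in>A. (x - y a) / (y c - y a) * W c / (y c - y b))
      = (\<Sum>c\<in>A. ((x - y a) / (y c - y a) * W c + (y a - x) * (W c / (y c - y b))) / (y a - y b))"
    by (rule sum.cong[OF refl])
  then show ?thesis
    unfolding Q1 Q2 Q3
    by (simp add: sum_divide_distrib sum.distrib sum_distrib_left add_divide_distrib)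
qed

text \<open>Induction on \<open>B\<close> and, inside, on \<open>A\<close>: in Neville's recurrence
  \<open>y a - x\<close> is nonnegative and \<open>y a - y b\<close> positive. For empty
  \<open>B\<close> the quotient is a full sum of basis polynomials, hence 1, or 0 if
  \<open>A\<close> is empty too.\<close>

lemma step_quotient_nonneg:
  assumes "finite A" "finite B" "inj_on y A" "\<And>a b. a \<in> A \<Longrightarrow> b \<in> B \<Longrightarrow> y b < y a"
    and "\<And>a. a \<in> A \<Longrightarrow> x \<le> y a"
  shows "0 \<le> step_quotient y A B x"
  using assms(2,1,3-)
proof (induction B arbitrary: A rule: finite_induct)
  case empty
  show ?case
  proof (cases "A = {}")
    case False
    then have "step_quotient y A {} x = 1"
      using lagrange_interpolation_exact[of A y 1 x] empty
      by (simp add: step_quotient_def poly_lagrange_poly card_gt_0_iff)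
    then show ?thesis by simp
  qed (simp add: step_quotient_def)
next
  case (insert b B)
  note less = insert.prems(3) and IH = insert.IH and B = insert.hyps
  show ?case
    using insert.prems
  proof (induction A rule: finite_induct)
    case (insert a A)
    have "0 \<le> step_quotient y (insert a A) B x"
      using insert.hyps insert.prems by (intro IH) auto
    moreover have "0 \<le> step_quotient y A (insert b B) x"
      using insert.prems by (intro insert.IH) (auto simp: inj_on_def)
    ultimately show ?case
      using insert.hyps insert.prems B by (subst step_quotient_insert_insert) (auto intro!: divide_nonneg_pos)
  qed (simp add: step_quotient_def)
qed

lemma sum_lagrange_poly_eq_step_quotient:
  assumes "finite A" "finite B" "A \<inter> B = {}"
  shows "(\<Sum>a\<in>A. poly (lagrange_poly y (A \<union> B) a) x) = (\<Prod>b\<in>B. x - y b) * step_quotient y A B x"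
  unfolding step_quotient_def sum_distrib_left
proof (rule sum.cong[OF refl])
  fix a assume a: "a \<in> A"
  have "A \<union> B - {a} = (A - {a}) \<union> B" using a assms by auto
  then have "poly (lagrange_poly y (A \<union> B) a) x
      = (\<Prod>j\<in>A - {a}. (x - y j) / (y a - y j)) * (\<Prod>b\<in>B. (x - y b) * (1 / (y a - y b)))"
    unfolding poly_lagrange_poly using assms by (simp add: prod.union_disjoint[of "A - {a}" B] disjoint_iff)
  then show "poly (lagrange_poly y (A \<union> B) a) x = (\<Prod>b\<in>B. x - y b) *
      ((\<Prod>j\<in>A - {a}. (x - y j) / (y a - y j)) * (\<Prod>b\<in>B. 1 / (y a - y b)))"
    by (simp only: prod.distrib mult_ac)
qed

text \<open>Moving the smallest node of \<open>A\<close> to \<open>B\<close> flips the sign of the sum, so the sum is dominated by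
  the basis polynomial that was removed.\<close>

lemma abs_sum_lagrange_poly_right_le:
  assumes fin: "finite A" "finite B" and inj: "inj_on y A"
    and less: "\<And>a b. a \<in> A \<Longrightarrow> b \<in> B \<Longrightarrow> y b < y a" and x: "\<And>a. a \<in> A \<Longrightarrow> x \<le> y a"
    and C: "\<And>a. a \<in> A \<Longrightarrow> \<bar>poly (lagrange_poly y (A \<union> B) a) x\<bar> \<le> C" and "0 \<le> C"
  shows "\<bar>\<Sum>a\<in>A. poly (lagrange_poly y (A \<union> B) a) x\<bar> \<le> C"
proof (cases "A = {}")
  case False
  have disj: "A \<inter> B = {}" using less by fastforce
  obtain k where k: "k \<in> A" "\<And>a. a \<in> A \<Longrightarrow> y k \<le> y a"
    using ex_min_if_finite[of "y ` A"] fin(1) False by (metis (no_types, lifting) empty_is_image finite_imageI image_iff linorder_not_less)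
  define A' B' where "A' = A - {k}" and "B' = insert k B"
  have A': "A = insert k A'" "k \<notin> A'" "finite A'" "finite B'" "A' \<inter> B' = {}" "A' \<union> B' = A \<union> B"
    using k fin disj by (auto simp: A'_def B'_def)
  have less': "y b < y a" if "a \<in> A'" "b \<in> B'" for a b
    using that less k inj unfolding A'_def B'_def inj_on_def by (force simp: less_le)
  have nonneg: "0 \<le> step_quotient y A B x" "0 \<le> step_quotient y A' B' x"
    using fin inj less less' x A' by (auto intro!: step_quotient_nonneg simp: inj_on_def)
  define P where "P = (\<Prod>b\<in>B. x - y b)"
  have "(\<Sum>a\<in>A. poly (lagrange_poly y (A \<union> B) a) x)
      = poly (lagrange_poly y (A \<union> B) k) x + (\<Sum>a\<in>A'. poly (lagrange_poly y (A \<union> B) a) x)"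
    using A'(1-3) by simp
  moreover have "(\<Prod>b\<in>B'. x - y b) = P * (x - y k)"
    using fin disj k by (simp add: B'_def P_def disjoint_iff)
  then have "(\<Sum>a\<in>A'. poly (lagrange_poly y (A \<union> B) a) x) = P * (x - y k) * step_quotient y A' B' x"
    using sum_lagrange_poly_eq_step_quotient[OF A'(3-5), of y x] unfolding A'(6) by simp
  moreover have S: "(\<Sum>a\<in>A. poly (lagrange_poly y (A \<union> B) a) x) = P * step_quotient y A B x"
    using sum_lagrange_poly_eq_step_quotient[OF fin disj] by (simp add: P_def)
  \<comment> \<open>The removed basis polynomial is \<open>P\<close> times a sum of two nonnegative
    terms, and the full sum is \<open>P\<close> times the first of them.\<close>
  ultimately have "poly (lagrange_poly y (A \<union> B) k) x
      = P * (step_quotient y A B x + (y k - x) * step_quotient y A' B' x)"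
    by (simp add: algebra_simps)
  moreover have "\<bar>P\<bar> * step_quotient y A B x
      \<le> \<bar>P\<bar> * (step_quotient y A B x + (y k - x) * step_quotient y A' B' x)"
    using nonneg x[OF k(1)] by (intro mult_left_mono) auto
  ultimately have "\<bar>P * step_quotient y A B x\<bar> \<le> \<bar>poly (lagrange_poly y (A \<union> B) k) x\<bar>"
    using nonneg x[OF k(1)] by (simp add: abs_mult)
  then show ?thesis
    using C[OF k(1)] S by simp
qed (use \<open>0 \<le> C\<close> in simp)

lemma poly_lagrange_poly_uminus:
  "poly (lagrange_poly (\<lambda>i. - y i) I k) (- x) = poly (lagrange_poly y I k) x"
proof -
  have "(- x - - y i) / (- y k - - y i) = (x - y i) / (y k - y i)" for i
    using minus_divide_divide[of "x - y i" "y k - y i"] by simp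
  then show ?thesis by (simp add: poly_lagrange_poly)
qed

text \<open>Reflection of the nodes and of \<open>x\<close> about 0 reduces this to the right-hand
  case.\<close>

lemma abs_sum_lagrange_poly_left_le:
  assumes "finite A" "finite B" and inj: "inj_on y A"
    and "\<And>a b. a \<in> A \<Longrightarrow> b \<in> B \<Longrightarrow> y a < y b" and "\<And>a. a \<in> A \<Longrightarrow> y a \<le> x"
    and "\<And>a. a \<in> A \<Longrightarrow> \<bar>poly (lagrange_poly y (A \<union> B) a) x\<bar> \<le> C" and "0 \<le> C"
  shows "\<bar>\<Sum>a\<in>A. poly (lagrange_poly y (A \<union> B) a) x\<bar> \<le> C"
  using abs_sum_lagrange_poly_right_le[of A B "\<lambda>i. - y i" "- x" C] assms
  by (simp add: poly_lagrange_poly_uminus inj_on_def)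

text \<open>If \<open>t < x\<close>, the basis polynomials summing to 1 turn the error into the sum
  over the nodes up to \<open>t\<close>, all left of \<open>x\<close>. Otherwise it is minus the sum
  over the nodes beyond \<open>t\<close>, all right of \<open>x\<close>.\<close>

lemma step_interpolation_error_le:
  assumes I: "finite I" "I \<noteq> {}" and inj: "inj_on y I"
    and C: "\<And>k. k \<in> I \<Longrightarrow> \<bar>poly (lagrange_poly y I k) x\<bar> \<le> C"
  shows "\<bar>of_bool (t < x) - (\<Sum>k\<in>I. of_bool (t < y k) * poly (lagrange_poly y I k) x)\<bar> \<le> C"
proof -
  define R where "R = {k \<in> I. t < y k}"
  define L where "L = {k \<in> I. y k \<le> t}"
  have RL: "finite R" "finite L" "R \<union> L = I" "L \<union> R = I" "R \<inter> L = {}" "R \<subseteq> I" "L \<subseteq> I"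
    using I by (auto simp: R_def L_def)
  have C0: "0 \<le> C"
    using I C abs_ge_zero order_trans by (metis ex_in_conv)
  have "(\<Sum>k\<in>I. of_bool (t < y k) * poly (lagrange_poly y I k) x) = (\<Sum>k\<in>I. if t < y k then poly (lagrange_poly y I k) x else 0)"
    by (intro sum.cong) auto
  also have "\<dots> = (\<Sum>k\<in>R. poly (lagrange_poly y I k) x)"
    using I by (simp add: R_def sum.inter_filter)
  finally have S: "(\<Sum>k\<in>I. of_bool (t < y k) * poly (lagrange_poly y I k) x) = (\<Sum>k\<in>R. poly (lagrange_poly y I k) x)" .
  show ?thesis
  proof (cases "t < x")
    case True
    have "(\<Sum>k\<in>R. poly (lagrange_poly y I k) x) + (\<Sum>k\<in>L. poly (lagrange_poly y I k) x)
        = (\<Sum>k\<in>I. poly (lagrange_poly y I k) x)"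
      using sum.union_disjoint[OF RL(1,2,5)] RL(3) by metis
    also have "\<dots> = 1"
      using lagrange_interpolation_exact[of I y 1 x] I inj by (simp add: card_gt_0_iff)
    finally have "of_bool (t < x) - (\<Sum>k\<in>R. poly (lagrange_poly y I k) x)
        = (\<Sum>k\<in>L. poly (lagrange_poly y I k) x)"
      using True by simp
    moreover have "\<bar>\<Sum>k\<in>L. poly (lagrange_poly y (L \<union> R) k) x\<bar> \<le> C"
      using True RL C C0 inj
      by (intro abs_sum_lagrange_poly_left_le) (auto simp: R_def L_def intro: inj_on_subset)
    ultimately show ?thesis
      by (simp add: S RL)
  next
    case False
    have "\<bar>\<Sum>k\<in>R. poly (lagrange_poly y (R \<union> L) k) x\<bar> \<le> C"
      using False RL C C0 inj
      by (intro abs_sum_lagrange_poly_right_le) (auto simp: R_def L_def intro: inj_on_subset)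
    then show ?thesis
      using False by (simp add: S RL)
  qed
qed

subsection \<open>Strongly normal point systems\<close>

text \<open>Differentiate the factorisation of \<open>node_poly X n\<close> twice at the node, where
  the linear factor vanishes.\<close>

lemma pderiv_lagrange_poly_node:
  assumes "inj_on (X n) {1..n}" "k \<in> {1..n}"
  shows "poly (pderiv (lagrange_poly (X n) {1..n} k)) (X n k)
    = poly (pderiv (pderiv (node_poly X n))) (X n k) / (2 * poly (pderiv (node_poly X n)) (X n k))"
proof -
  define c where "c = poly (pderiv (node_poly X n)) (X n k)"
  define l where "l = lagrange_poly (X n) {1..n} k"
  have c: "c \<noteq> 0"
    using pderiv_node_poly(1)[of X n k, OF assms] by (simp add: c_def)
  have "node_poly X n = smult c ([:- X n k, 1:] * l)"
    using pderiv_node_poly(2)[of X n k, OF assms] by (simp add: c_def l_def)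
  then have "poly (pderiv (pderiv (node_poly X n))) (X n k) = 2 * c * poly (pderiv l) (X n k)"
    by (simp add: pderiv_smult pderiv_mult pderiv_add pderiv_pCons del: mult_pCons_left) 
  then show ?thesis
    unfolding c_def[symmetric] l_def[symmetric] using c by simp
qed

text \<open>The left-hand side is the Hermite--Fejer interpolant of the constant 1.\<close>

lemma sum_fejer_v_lagrange_sq:
  assumes inj: "inj_on (X n) {1..n}" and n: "n \<ge> 1"
  shows "(\<Sum>k=1..n. fejer_v X n k x * (poly (lagrange_poly (X n) {1..n} k) x)\<^sup>2) = 1"
proof -
  define \<omega> where "\<omega> = node_poly X n"
  define l where "l = lagrange_poly (X n) {1..n}"
  define a where "a k = poly (pderiv (pderiv \<omega>)) (X n k) / poly (pderiv \<omega>) (X n k)" for k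
  define v where "v k = [:1 + X n k * a k, - a k:]" for k
  \<comment> \<open>\<open>R\<close> has degree below \<open>2 * n\<close> and vanishes with its
    derivative at all \<open>n\<close> nodes, which forces \<open>R = 0\<close>.\<close>
  define R where "R = (\<Sum>k\<in>{1..n}. v k * (l k)\<^sup>2) - 1"
  have v: "poly (v k) t = fejer_v X n k t" for k t
  proof -
    have "fejer_v X n k t = 1 - (t - X n k) * a k"
      by (simp add: fejer_v_def a_def \<omega>_def)
    then show ?thesis by (simp add: v_def algebra_simps)
  qed
  have lj: "poly (l k) (X n j) = (if j = k then 1 else 0)" if "j \<in> {1..n}" "k \<in> {1..n}" for j k
    using poly_lagrange_poly_node[OF _ inj that] by (simp add: l_def)
  have R0: "poly R (X n j) = 0" if j: "j \<in> {1..n}" for j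
  proof -
    have "(\<Sum>k\<in>{1..n}. poly (v k * (l k)\<^sup>2) (X n j)) = (\<Sum>k\<in>{1..n}. if k = j then 1 else 0)"
      using j by (intro sum.cong refl) (auto simp: lj v_def algebra_simps)
    then show ?thesis using j by (simp add: R_def poly_sum)
  qed
  have R1: "poly (pderiv R) (X n j) = 0" if j: "j \<in> {1..n}" for j
  proof -
    \<comment> \<open>For \<open>k = j\<close> the slope \<open>- a j\<close> of \<open>v j\<close>
      cancels twice the slope of \<open>l j\<close>; for other \<open>k\<close> the square has a
      double zero.\<close>
    have "poly (pderiv (v k * (l k)\<^sup>2)) (X n j) = 0" if k: "k \<in> {1..n}" for k
    proof (cases "k = j")
      case True
      have "2 * poly (pderiv (l j)) (X n j) = a j"
        using pderiv_lagrange_poly_node[of X n, OF inj j] by (simp add: a_def \<omega>_def l_def)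
      moreover have "poly (v j) (X n j) = 1" "poly (pderiv (v j)) (X n j) = - a j"
        by (simp_all add: v_def pderiv_pCons algebra_simps)
      ultimately show ?thesis
        unfolding True power2_eq_square pderiv_mult poly_add poly_mult using lj[OF j j] by simp
    next
      case False
      then show ?thesis
        using lj[OF j k] by (simp add: power2_eq_square pderiv_mult)
    qed
    then show ?thesis
      by (simp add: R_def pderiv_diff higher_pderiv_sum[of 1, simplified] poly_sum)
  qed
  have card: "card (X n ` {1..n}) = n"
    using inj by (simp add: card_image)
  have deg\<omega>: "degree \<omega> = n"
    unfolding \<omega>_def node_poly_def by (subst degree_prod_eq_sum_degree) auto
  have \<omega>0: "poly \<omega> (X n j) = 0" if "j \<in> {1..n}" for j
    using that unfolding \<omega>_def node_poly_def by (auto simp: poly_prod intro!: prod_zero)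
  have \<omega>1: "poly (pderiv \<omega>) (X n j) \<noteq> 0" if "j \<in> {1..n}" for j
    using pderiv_node_poly(1)[of X n, OF inj that] by (simp add: \<omega>_def)
  have "degree (l k) \<le> n - 1" if "k \<in> {1..n}" for k
    using degree_lagrange_poly_less[OF _ that, of "X n"] by (simp add: l_def)
  then have "degree (v k * (l k)\<^sup>2) \<le> 1 + 2 * (n - 1)" if "k \<in> {1..n}" for k
    using that order_trans[OF degree_power_le[of "l k" 2]]
    by (intro order_trans[OF degree_mult_le] add_mono) (auto simp: v_def mult.commute)
  then have degR: "degree R < 2 * n"
    using n unfolding R_def
    by (intro le_less_trans[OF degree_diff_le[of _ "1 + 2 * (n - 1)"]] degree_sum_le) auto
  have dvd: "q = 0" if "degree q < n" "\<And>j. j \<in> {1..n} \<Longrightarrow> poly q (X n j) = 0" for q :: "real poly"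
    by (rule poly_eqI_degree[of "X n ` {1..n}"]) (use that card n in auto)
  have \<omega>nz: "\<omega> \<noteq> 0" using deg\<omega> n by auto
  \<comment> \<open>The double zeros are removed by dividing by \<omega>: first the remainder, then
    the quotient has degree below \<open>n\<close> and vanishes at \<open>n\<close> nodes.\<close>
  have "R mod \<omega> = 0"
  proof (rule dvd)
    show "degree (R mod \<omega>) < n"
      using degree_mod_less[OF \<omega>nz, of R] deg\<omega> n by auto
    fix j assume j: "j \<in> {1..n}"
    have "poly R (X n j) = poly (R div \<omega> * \<omega> + R mod \<omega>) (X n j)" by simp
    also have "\<dots> = poly (R mod \<omega>) (X n j)"
      unfolding poly_add poly_mult \<omega>0[OF j] by simp
    finally show "poly (R mod \<omega>) (X n j) = 0"
      using R0[OF j] by simp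
  qed
  then have R: "R = \<omega> * (R div \<omega>)"
    using div_mult_mod_eq[of R \<omega>] by (simp add: mult.commute)
  have "R div \<omega> = 0"
  proof (rule dvd)
    show "degree (R div \<omega>) < n"
    proof (cases "R div \<omega> = 0")
      case False
      have "degree R = n + degree (R div \<omega>)"
        by (subst R) (simp add: degree_mult_eq \<omega>nz False deg\<omega>)
      then show ?thesis using degR by simp
    qed (use n in simp)
    fix j assume j: "j \<in> {1..n}"
    have "poly (pderiv (\<omega> * (R div \<omega>))) (X n j) = 0"
      using R1[OF j] R by simp
    then show "poly (R div \<omega>) (X n j) = 0"
      using \<omega>0[OF j] \<omega>1[OF j] by (simp add: pderiv_mult)
  qed
  then have "R = 0" using R by simp
  then have "poly (\<Sum>k\<in>{1..n}. v k * (l k)\<^sup>2) x = 1"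
    by (simp add: R_def)
  then show ?thesis
    by (simp add: poly_sum v l_def)
qed

text \<open>All terms of the Hermite-Fejer identity are nonnegative, so the \<open>k\<close>-th one,
  at least \<open>c\<close> times a square, is at most 1.\<close>

lemma strongly_normal_lagrange_le:
  assumes sn: "strongly_normal X c" and inj: "inj_on (X n) {1..n}"
    and k: "k \<in> {1..n}" and x: "x \<in> {-1..1}"
  shows "\<bar>poly (lagrange_poly (X n) {1..n} k) x\<bar> \<le> 1 / sqrt c"
proof -
  have c: "c > 0" and v: "\<And>j. j \<in> {1..n} \<Longrightarrow> c \<le> fejer_v X n j x"
    using sn x k by (auto simp: strongly_normal_def)
  have "c * (poly (lagrange_poly (X n) {1..n} k) x)\<^sup>2
      \<le> fejer_v X n k x * (poly (lagrange_poly (X n) {1..n} k) x)\<^sup>2"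
    using v[OF k] by (intro mult_right_mono) auto
  also have "\<dots> \<le> (\<Sum>j=1..n. fejer_v X n j x * (poly (lagrange_poly (X n) {1..n} j) x)\<^sup>2)"
    using k v c by (intro member_le_sum) (auto intro!: mult_nonneg_nonneg intro: order_trans[of 0 c])
  also have "\<dots> = 1"
    using k by (intro sum_fejer_v_lagrange_sq inj) auto
  finally have "(poly (lagrange_poly (X n) {1..n} k) x)\<^sup>2 \<le> 1 / c"
    using c by (simp add: field_simps)
  then have "sqrt ((poly (lagrange_poly (X n) {1..n} k) x)\<^sup>2) \<le> sqrt (1 / c)"
    by (rule real_sqrt_le_mono)
  then show ?thesis by (simp add: real_sqrt_divide)
qed

lemma pointsystem_nodes:
  assumes X: "pointsystem X" and n: "n \<ge> 1"
  shows "inj_on (X n) {1..n}" and "X n ` {1..n} \<subseteq> {-1..1}"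
proof -
  have step: "X n (i + Suc d) < X n i" if "1 \<le> i" "i + Suc d \<le> n" for i d
    using that
  proof (induction d)
    case 0
    then show ?case using X by (auto simp: pointsystem_def)
  next
    case (Suc d)
    then have "X n (Suc (i + Suc d)) < X n (i + Suc d)"
      using X by (auto simp: pointsystem_def)
    then show ?case using Suc by simp
  qed
  have dec: "X n j < X n i" if "1 \<le> i" "i < j" "j \<le> n" for i j
    using step[of i "j - Suc i"] that by simp
  show "inj_on (X n) {1..n}"
  proof (rule linorder_inj_onI)
    fix i j assume "i < j" "i \<in> {1..n}" "j \<in> {1..n}"
    then show "X n i \<noteq> X n j" using dec[of i j] by simp
  qed (use linear in blast)
  show "X n ` {1..n} \<subseteq> {-1..1}"
  proof
    fix z assume "z \<in> X n ` {1..n}"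
    then obtain k where k: "1 \<le> k" "k \<le> n" "z = X n k" by auto
    have "X n k \<le> X n 1" "X n n \<le> X n k"
      using dec[of 1 k] dec[of k n] k by (cases "k = 1"; cases "k = n"; force)+
    moreover have "-1 \<le> X n n" "X n 1 \<le> 1"
      using X n by (auto simp: pointsystem_def)
    ultimately show "z \<in> {-1..1}"
      using k by auto
  qed
qed

subsection \<open>Iterated Peano kernels\<close>

text \<open>The invariant carried through the repeated integrations: each one lowers the order
  \<open>m\<close> by one and improves the bound \<open>M\<close> by a Bohr factor.\<close>

definition annihilating_kernel :: "nat \<Rightarrow> real \<Rightarrow> (real \<Rightarrow> real) \<Rightarrow> bool" where
  "annihilating_kernel m M h \<longleftrightarrow>
     h integrable_on {-1..1} \<and> (\<forall>t\<in>{-1..1}. \<bar>h t\<bar> \<le> M) \<and>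
     (\<forall>p. degree p \<le> m \<longrightarrow> integral {-1..1} (\<lambda>t. poly p t * h t) = 0)"

lemma annihilating_kernelD:
  assumes "annihilating_kernel m M h"
  shows "h integrable_on {-1..1}" "\<And>t. t \<in> {-1..1} \<Longrightarrow> \<bar>h t\<bar> \<le> M" "bounded (h ` {-1..1})"
    and "degree p \<le> m \<Longrightarrow> integral {-1..1} (\<lambda>t. poly p t * h t) = 0"
    and "integral {-1..1} h = 0" "tail_integral h (-1) = 0" "tail_integral h 1 = 0"
proof -
  show *: "h integrable_on {-1..1}" "\<And>t. t \<in> {-1..1} \<Longrightarrow> \<bar>h t\<bar> \<le> M"
    "\<And>p. degree p \<le> m \<Longrightarrow> integral {-1..1} (\<lambda>t. poly p t * h t) = 0"
    using assms by (auto simp: annihilating_kernel_def)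
  show "bounded (h ` {-1..1})"
    by (rule boundedI[of _ M]) (use *(2) in auto)
  show "integral {-1..1} h = 0"
    using *(3)[of 1] by simp
  then show "tail_integral h (-1) = 0" "tail_integral h 1 = 0"
    by (simp_all add: tail_integral_def)
qed

section \<open>Antiderivatives of polynomials and integration of annihilating kernels\<close>

lemma poly_antiderivative:
  fixes p :: "real poly"
  shows "\<exists>q. pderiv q = p \<and> degree q \<le> Suc (degree p)"
proof (intro exI conjI)
  define q where "q = (\<Sum>i\<le>degree p. monom (coeff p i / real (Suc i)) (Suc i))"
  have "pderiv q = (\<Sum>i\<le>degree p. monom (coeff p i) i)"
    unfolding q_def higher_pderiv_sum[of 1, simplified] pderiv_monom
    by (intro sum.cong refl) (simp del: of_nat_Suc)
  then show "pderiv q = p" by (simp add: poly_as_sum_of_monoms)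
  show "degree q \<le> Suc (degree p)"
    unfolding q_def by (intro degree_sum_le) (auto intro: order_trans[OF degree_monom_le])
qed

lemma poly_eq_integral_pderiv:
  fixes q :: "real poly"
  assumes "a \<le> t"
  shows "poly q t = poly q a + integral {a..t} (poly (pderiv q))"
proof -
  have "(poly (pderiv q) has_integral poly q t - poly q a) {a..t}"
    using assms poly_DERIV[of q]
    by (intro fundamental_theorem_of_calculus)
      (auto simp: has_real_derivative_iff_has_vector_derivative intro: has_vector_derivative_at_within)
  then show ?thesis by (simp add: integral_unique)
qed

text \<open>Integrate by parts with an antiderivative of \<open>p\<close>, whose degree is still at
  most \<open>m\<close>.\<close>

lemma integral_poly_mult_tail_integral:
  assumes h: "annihilating_kernel m M h" and p: "degree p < m"
  shows "integral {-1..1} (\<lambda>t. poly p t * tail_integral h t) = 0"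
proof -
  obtain q where q: "pderiv q = p" "degree q \<le> Suc (degree p)"
    using poly_antiderivative by blast
  have c: "continuous_on {-1..1} (poly p)" by (intro continuous_intros)
  have "integral {-1..1} (\<lambda>t. poly p t * tail_integral h t) = integral {-1..1} (\<lambda>t. poly q t * h t)"
  proof (rule integral_by_parts_tail_integral[symmetric])
    show "h integrable_on {-1..1}" "bounded (h ` {-1..1})" "integral {-1..1} h = 0"
      using annihilating_kernelD[OF h] by auto
    show "poly p integrable_on {-1..1}" "bounded (poly p ` {-1..1})"
      using integrable_continuous_interval[OF c] compact_imp_bounded[OF compact_continuous_image[OF c]]
      by auto
    show "poly q t = poly q (-1) + integral {-1..t} (poly p)" if "t \<in> {-1..1}" for t
      using poly_eq_integral_pderiv[of "-1" t q] that unfolding q(1) by simp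
  qed
  also have "\<dots> = 0"
    using annihilating_kernelD(4)[OF h, of q] p q by simp
  finally show ?thesis .
qed

lemma annihilating_kernel_tail_lipschitz:
  assumes "annihilating_kernel m M h" "u \<in> {-1..1}" "v \<in> {-1..1}"
  shows "\<bar>tail_integral h u - tail_integral h v\<bar> \<le> M * \<bar>u - v\<bar>"
  using tail_integral_lipschitz annihilating_kernelD[OF assms(1)] assms(2,3) by blast

text \<open>For \<open>m \<ge> 3\<close> the Bohr-type inequality is even better by one. For smaller
  \<open>m\<close>, the Lipschitz bound from the nearer endpoint, at distance at most 1, gives
  \<open>M\<close>, and \<open>pi / (m + 1)\<close> is at least 1.\<close>

lemma abs_tail_integral_le:
  assumes h: "annihilating_kernel m M h" and u: "u \<in> {-1..1}"
  shows "\<bar>tail_integral h u\<bar> \<le> M * (pi / real (m + 1))"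
proof -
  note D = annihilating_kernelD[OF h]
  note L = annihilating_kernel_tail_lipschitz[OF h]
  have M0: "0 \<le> M"
    using D(2)[of 0] by auto
  show ?thesis
  proof (cases "m \<ge> 3")
    case True
    have "\<bar>tail_integral h u\<bar> \<le> M * (pi / real (m + 2))"
      using integral_poly_mult_tail_integral[OF h] D(6,7) L True u
      by (intro bohr_inequality_interval) auto
    also have "\<dots> \<le> M * (pi / real (m + 1))"
      using M0 by (intro mult_left_mono divide_left_mono) auto
    finally show ?thesis .
  next
    case False
    have "\<bar>tail_integral h u\<bar> \<le> M * \<bar>u - 1\<bar>" "\<bar>tail_integral h u\<bar> \<le> M * \<bar>u + 1\<bar>"
      using L[of u 1] L[of u "-1"] D(6,7) u by simp_all
    moreover have "M * \<bar>u - 1\<bar> \<le> M * 1 \<or> M * \<bar>u + 1\<bar> \<le> M * 1"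
      using u M0 by (cases "u \<ge> 0") (auto intro!: mult_left_le)
    ultimately have "\<bar>tail_integral h u\<bar> \<le> M * 1"
      by linarith
    also have "\<dots> \<le> M * (pi / real (m + 1))"
      using M0 False pi_gt3 by (intro mult_left_mono) (auto simp: field_simps)
    finally show ?thesis .
  qed
qed

lemma annihilating_kernel_tail_integral:
  assumes h: "annihilating_kernel (Suc m) M h"
  shows "annihilating_kernel m (M * (pi / real (m + 2))) (tail_integral h)"
  unfolding annihilating_kernel_def
proof (intro conjI ballI allI impI)
  show "tail_integral h integrable_on {-1..1}"
    using annihilating_kernel_tail_lipschitz[OF h]
    by (intro integrable_continuous_interval lipschitz_abs_imp_continuous_on)
  show "\<bar>tail_integral h t\<bar> \<le> M * (pi / real (m + 2))" if "t \<in> {-1..1}" for t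
    using abs_tail_integral_le[OF h that] by simp
  show "integral {-1..1} (\<lambda>t. poly p t * tail_integral h t) = 0" if "degree p \<le> m" for p
    using integral_poly_mult_tail_integral[OF h, of p] that by simp
qed

text \<open>Passing from \<open>s\<close> to \<open>Suc s\<close> starts at order
  \<open>n - 2 - s\<close> and contributes \<open>pi / (n - Suc s)\<close>;
  \<open>s + 2 \<le> n\<close> keeps the truncated subtraction exact.\<close>

lemma annihilating_kernel_iterate:
  assumes h: "annihilating_kernel (n - 2) M h" and "s + 2 \<le> n"
  shows "annihilating_kernel (n - 2 - s) (M * (pi ^ s / (\<Prod>j=1..s. real n - real j)))
    ((tail_integral ^^ s) h)"
  using assms(2)
proof (induction s)
  case 0
  then show ?case using h by simp
next
  case (Suc s)
  define m where "m = n - 2 - Suc s"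
  have m: "n - 2 - s = Suc m" "real (m + 2) = real n - real (Suc s)"
    using Suc.prems by (auto simp: m_def of_nat_diff)
  have "annihilating_kernel (Suc m) (M * (pi ^ s / (\<Prod>j=1..s. real n - real j))) ((tail_integral ^^ s) h)"
    using Suc m by simp
  from annihilating_kernel_tail_integral[OF this]
  have "annihilating_kernel m (M * (pi ^ s / (\<Prod>j=1..s. real n - real j)) * (pi / (real n - real (Suc s))))
    ((tail_integral ^^ Suc s) h)"
    unfolding m(2) by simp
  then show ?case
    by (simp add: m_def mult_ac)
qed

text \<open>Only \<open>r - 1\<close> factors come from iterating. The last one,
  \<open>pi / (n - r)\<close>, bounds the tail integrals in the second mean value estimate, which
  needs order \<open>n - 1 - r \<ge> 0\<close> only.\<close>

lemma peano_integral_bound: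
  assumes h: "annihilating_kernel (n - 2) M h" and r: "1 \<le> r" "r + 1 \<le> n"
    and g: "bounded_variation g (-1) 1"
  shows "\<bar>integral {-1..1} (\<lambda>t. g t * (tail_integral ^^ (r - 1)) h t)\<bar>
    \<le> M * (pi ^ r / (\<Prod>j=1..r. real n - real j)) * total_variation g (-1) 1"
proof -
  obtain s where s: "r = Suc s" using r by (cases r) auto
  define k where "k = (tail_integral ^^ s) h"
  have k: "annihilating_kernel (n - 2 - s) (M * (pi ^ s / (\<Prod>j=1..s. real n - real j))) k"
    unfolding k_def using r s by (intro annihilating_kernel_iterate h) auto
  have "real (n - 2 - s + 1) = real n - real (Suc s)"
    using r s by (auto simp: of_nat_diff)
  note k_bound = abs_tail_integral_le[OF k, unfolded this]
  have "\<bar>integral {u..1} k\<bar> \<le> M * (pi ^ r / (\<Prod>j=1..r. real n - real j))" if "u \<in> {-1..1}" for u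
    using k_bound[OF that] by (simp add: tail_integral_def s mult_ac del: of_nat_Suc)
  then show ?thesis
    using annihilating_kernelD[OF k] g unfolding s k_def[symmetric] diff_Suc_1
    by (intro integral_mult_bounded_variation_bound) auto
qed

subsection \<open>The Peano kernel of the interpolation error\<close>

definition interp_kernel :: "('i \<Rightarrow> real) \<Rightarrow> 'i set \<Rightarrow> real \<Rightarrow> real \<Rightarrow> real" where
  "interp_kernel y I x t =
     of_bool (t < x) - (\<Sum>k\<in>I. of_bool (t < y k) * poly (lagrange_poly y I k) x)"

lemma has_integral_of_bool_less_mult:
  fixes g :: "real \<Rightarrow> real"
  assumes g: "g integrable_on {-1..1}" and z: "z \<in> {-1..1}"
  shows "((\<lambda>t. of_bool (t < z) * g t) has_integral integral {-1..z} g) {-1..1}"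
proof -
  have "g integrable_on {-1..z}"
    using g z by (auto intro: integrable_on_subinterval)
  then have "((\<lambda>t. of_bool (t < z) * g t) has_integral integral {-1..z} g) {-1..z}"
    by (intro has_integral_spike_finite[of "{z}", OF _ _ integrable_integral]) auto
  moreover have "((\<lambda>t. of_bool (t < z) * g t) has_integral 0) {z..1}"
    by (rule has_integral_is_0) auto
  ultimately show ?thesis
    using has_integral_combine[of "-1" z 1] z by fastforce
qed

text \<open>Write \<open>F z - F (-1)\<close> as the integral of \<open>g\<close> against the step
  at \<open>z\<close>. The constant \<open>F (-1)\<close> drops out since the basis polynomials sum
  to 1.\<close>

lemma has_integral_interp_kernel:
  fixes F g :: "real \<Rightarrow> real"
  assumes I: "finite I" "I \<noteq> {}" "inj_on y I" and y: "y ` I \<subseteq> {-1..1}" and x: "x \<in> {-1..1}"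
    and g: "g integrable_on {-1..1}"
    and F: "\<And>t. t \<in> {-1..1} \<Longrightarrow> F t = F (-1) + integral {-1..t} g"
  shows "((\<lambda>t. g t * interp_kernel y I x t) has_integral
    F x - (\<Sum>k\<in>I. F (y k) * poly (lagrange_poly y I k) x)) {-1..1}"
proof -
  define l where "l k = poly (lagrange_poly y I k) x" for k
  have "((\<lambda>t. of_bool (t < x) * g t - (\<Sum>k\<in>I. l k * (of_bool (t < y k) * g t))) has_integral
      integral {-1..x} g - (\<Sum>k\<in>I. l k * integral {-1..y k} g)) {-1..1}"
    using I(1) x y g
    by (intro has_integral_diff has_integral_sum has_integral_mult_right
        has_integral_of_bool_less_mult) auto
  moreover have "of_bool (t < x) * g t - (\<Sum>k\<in>I. l k * (of_bool (t < y k) * g t)) = g t * interp_kernel y I x t" for t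
    by (simp add: interp_kernel_def l_def sum_distrib_left right_diff_distrib mult_ac)
  moreover have "integral {-1..x} g - (\<Sum>k\<in>I. l k * integral {-1..y k} g) = F x - (\<Sum>k\<in>I. F (y k) * l k)"
  proof -
    have "(\<Sum>k\<in>I. l k) = 1"
      using lagrange_interpolation_exact[of I y 1 x] I by (simp add: l_def card_gt_0_iff)
    then have "F (-1) = (\<Sum>k\<in>I. F (-1) * l k)"
      by (simp add: sum_distrib_left[symmetric])
    moreover have "(\<Sum>k\<in>I. F (y k) * l k) = (\<Sum>k\<in>I. F (-1) * l k) + (\<Sum>k\<in>I. l k * integral {-1..y k} g)"
      unfolding sum.distrib[symmetric]
    proof (rule sum.cong[OF refl])
      fix k assume "k \<in> I"
      then have "F (y k) = F (-1) + integral {-1..y k} g" using y by (intro F) auto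
      then show "F (y k) * l k = F (-1) * l k + l k * integral {-1..y k} g"
        by (simp add: algebra_simps)
    qed
    ultimately show ?thesis using F[OF x] by simp
  qed
  ultimately show ?thesis by (simp add: l_def)
qed

lemma annihilating_kernel_interp_kernel:
  assumes I: "finite I" "card I \<ge> 2" "inj_on y I" and y: "y ` I \<subseteq> {-1..1}" and x: "x \<in> {-1..1}"
    and C: "\<And>k. k \<in> I \<Longrightarrow> \<bar>poly (lagrange_poly y I k) x\<bar> \<le> C"
  shows "annihilating_kernel (card I - 2) C (interp_kernel y I x)"
  unfolding annihilating_kernel_def
proof (intro conjI ballI allI impI)
  have I0: "I \<noteq> {}" using I(2) by auto
  show "interp_kernel y I x integrable_on {-1..1}"
    \<comment> \<open>Density 1, with the identity as its antiderivative, exhibits the kernel itself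
      as an integrand.\<close>
    using has_integral_interp_kernel[OF I(1) I0 I(3) y x, of "\<lambda>_. 1" "\<lambda>t. t"]
    by (auto simp: has_integral_iff)
  show "\<bar>interp_kernel y I x t\<bar> \<le> C" for t
    unfolding interp_kernel_def by (rule step_interpolation_error_le[OF I(1) I0 I(3) C])
  fix p :: "real poly" assume p: "degree p \<le> card I - 2"
  obtain q where q: "pderiv q = p" "degree q \<le> Suc (degree p)"
    using poly_antiderivative by blast
  have "((\<lambda>t. poly p t * interp_kernel y I x t) has_integral
      poly q x - (\<Sum>k\<in>I. poly q (y k) * poly (lagrange_poly y I k) x)) {-1..1}"
  proof (rule has_integral_interp_kernel[OF I(1) I0 I(3) y x])
    show "poly p integrable_on {-1..1}"
      by (intro integrable_continuous_interval continuous_intros)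
    show "poly q t = poly q (-1) + integral {-1..t} (poly p)" if "t \<in> {-1..1}" for t
      using poly_eq_integral_pderiv[of "-1" t q] that unfolding q(1) by simp
  qed
  moreover have "(\<Sum>k\<in>I. poly q (y k) * poly (lagrange_poly y I k) x) = poly q x"
    using p q I(2) by (intro lagrange_interpolation_exact I) auto
  ultimately show "integral {-1..1} (\<lambda>t. poly p t * interp_kernel y I x t) = 0"
    by (simp add: integral_unique)
qed

lemma integral_iterated_by_parts:
  fixes E :: "nat \<Rightarrow> real \<Rightarrow> real"
  assumes h: "annihilating_kernel (n - 2) M h" and "s + 2 \<le> n"
    and E: "\<And>j t. j \<le> s \<Longrightarrow> t \<in> {-1..1} \<Longrightarrow> E j t = E j (-1) + integral {-1..t} (E (Suc j))"
    and Ei: "\<And>j. j \<le> s \<Longrightarrow> E (Suc j) integrable_on {-1..1}"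
    and Eb: "\<And>j. j \<le> s \<Longrightarrow> bounded (E (Suc j) ` {-1..1})"
  shows "integral {-1..1} (\<lambda>t. E 1 t * h t)
    = integral {-1..1} (\<lambda>t. E (Suc s) t * (tail_integral ^^ s) h t)"
  using assms(2) E Ei Eb
proof (induction s)
  case (Suc s)
  have k: "annihilating_kernel (n - 2 - s) (M * (pi ^ s / (\<Prod>j=1..s. real n - real j))) ((tail_integral ^^ s) h)"
    using Suc.prems by (intro annihilating_kernel_iterate h) auto
  have "integral {-1..1} (\<lambda>t. E 1 t * h t) = integral {-1..1} (\<lambda>t. E (Suc s) t * (tail_integral ^^ s) h t)"
    by (rule Suc.IH; (rule Suc.prems)?) (use Suc.prems(1) in auto)
  also have "\<dots> = integral {-1..1} (\<lambda>t. E (Suc (Suc s)) t * tail_integral ((tail_integral ^^ s) h) t)"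
    by (rule integral_by_parts_tail_integral annihilating_kernelD(1,3,5)[OF k] Suc.prems(2-4) | simp)+
  finally show ?case by simp
qed simp

text \<open>Overriding the entry \<open>Suc m\<close> by \<open>g\<close> makes the density the next
  member of the chain, so one formula covers both the genuine derivatives and the top level.\<close>

lemma indefinite_integral_derivatives:
  assumes D: "derivatives_upto m f D"
    and g: "g integrable_on {-1..1}" "\<And>t. t \<in> {-1..1} \<Longrightarrow> D m t = D m (-1) + integral {-1..t} g"
    and j: "j \<le> m"
  shows "continuous_on {-1..1} (D j)"
    and "t \<in> {-1..1} \<Longrightarrow> D j t = D j (-1) + integral {-1..t} ((D(Suc m := g)) (Suc j))"
proof -
  have der: "(D i has_real_derivative D (Suc i) t) (at t within {-1..1})"
    if "i < m" "t \<in> {-1..1}" for i t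
    using D that by (auto simp: derivatives_upto_def)
  show "continuous_on {-1..1} (D j)"
  proof (cases "j = m")
    case True
    have "continuous_on {-1..1} (\<lambda>t. D m (-1) + integral {-1..t} g)"
      by (intro continuous_intros indefinite_integral_continuous_1 g)
    then show ?thesis
      unfolding True by (rule continuous_on_eq) (rule g(2)[symmetric])
  next
    case False
    then show ?thesis
      using der[of j] j by (intro DERIV_continuous_on) auto
  qed
  show "D j t = D j (-1) + integral {-1..t} ((D(Suc m := g)) (Suc j))" if t: "t \<in> {-1..1}"
  proof (cases "j = m")
    case True
    then show ?thesis using g(2)[OF t] by simp
  next
    case False
    then have "(D j has_real_derivative D (Suc j) s) (at s within {-1..t})" if "s \<in> {-1..t}" for s
      by (rule_tac DERIV_subset[OF der]) (use j t that in auto)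
    then have "(D (Suc j) has_integral D j t - D j (-1)) {-1..t}"
      using t by (intro fundamental_theorem_of_calculus)
        (auto simp: has_real_derivative_iff_has_vector_derivative[symmetric])
    then show ?thesis using False by (simp add: integral_unique)
  qed
qed

lemma interp_error_bound:
  assumes r: "r \<ge> 1" and D: "derivatives_upto (r - 1) f D" and g: "g \<in> bv_densities (D (r - 1))"
    and X: "pointsystem X" and sn: "strongly_normal X c" and n: "n \<ge> r + 1" and x: "x \<in> {-1..1}"
  shows "\<bar>interp_error X n f x\<bar>
    \<le> pi ^ r / (sqrt c * (\<Prod>j=1..r. real n - real j)) * total_variation g (-1) 1"
proof -
  obtain m where m: "r = Suc m" using r by (cases r) auto
  have inj: "inj_on (X n) {1..n}" and nodes: "X n ` {1..n} \<subseteq> {-1..1}"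
    using pointsystem_nodes[OF X] n by auto
  have gi: "g integrable_on {-1..1}" and gbv: "bounded_variation g (-1) 1"
    using g by (simp_all add: bv_densities_def absolutely_integrable_on_def)
  have gD: "D m t = D m (-1) + integral {-1..t} g" if "t \<in> {-1..1}" for t
    using g that unfolding bv_densities_def m diff_Suc_1 by blast
  have D': "derivatives_upto m f D" using D m by simp
  note ind = indefinite_integral_derivatives[OF D' gi gD]
  define E where "E = D(Suc m := g)"
  define h where "h = interp_kernel (X n) {1..n} x"
  have h: "annihilating_kernel (n - 2) (1 / sqrt c) h"
    using annihilating_kernel_interp_kernel[of "{1..n}" "X n" x "1 / sqrt c"] inj nodes x n r
      strongly_normal_lagrange_le[OF sn inj _ x] by (simp add: h_def)
  have Ei: "E (Suc j) integrable_on {-1..1}" and Eb: "bounded (E (Suc j) ` {-1..1})" if "j \<le> m" for j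
  proof -
    have "E (Suc j) integrable_on {-1..1} \<and> bounded (E (Suc j) ` {-1..1})"
    proof (cases "j = m")
      case True
      then show ?thesis using gi bounded_variation_imp_bounded[OF gbv] by (simp add: E_def)
    next
      case False
      then have "continuous_on {-1..1} (E (Suc j))"
        using ind(1)[of "Suc j"] that by (simp add: E_def)
      then show ?thesis
        using integrable_continuous_interval compact_imp_bounded[OF compact_continuous_image] by blast
    qed
    then show "E (Suc j) integrable_on {-1..1}" "bounded (E (Suc j) ` {-1..1})" by auto
  qed
  have E: "E j t = E j (-1) + integral {-1..t} (E (Suc j))" if "j \<le> m" "t \<in> {-1..1}" for j t
    using ind(2)[OF _ that] that by (simp add: E_def)
  have f: "D 0 t = f t" if "t \<in> {-1..1}" for t
    using D that by (simp add: derivatives_upto_def)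
  have "interp_error X n f x
      = D 0 x - (\<Sum>k\<in>{1..n}. D 0 (X n k) * poly (lagrange_poly (X n) {1..n} k) x)"
    unfolding interp_error_def f[OF x]
  proof (intro arg_cong2[where f = "(-)"] sum.cong refl)
    fix k assume k: "k \<in> {1..n}"
    then have "X n k \<in> {-1..1}" using nodes by blast
    then have "D 0 (X n k) = f (X n k)" by (rule f)
    then show "f (X n k) * poly (lagrange_basis X n k) x
        = D 0 (X n k) * poly (lagrange_poly (X n) {1..n} k) x"
      using lagrange_basis_eq_lagrange_poly[of X n, OF inj k] by simp
  qed
  also have "\<dots> = integral {-1..1} (\<lambda>t. E 1 t * h t)"
    unfolding h_def
  proof (rule integral_unique[symmetric], rule has_integral_interp_kernel)
    show "E 1 integrable_on {-1..1}"
      using Ei[of 0] by simp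
    show "D 0 t = D 0 (-1) + integral {-1..t} (E 1)" if "t \<in> {-1..1}" for t
      using E[of 0 t] that by (simp add: E_def)
  qed (use inj nodes x n in auto)
  also have "\<dots> = integral {-1..1} (\<lambda>t. E (Suc m) t * (tail_integral ^^ m) h t)"
    by (rule integral_iterated_by_parts[OF h]; (rule E Ei Eb)?) (use n m in auto)
  finally have "\<bar>interp_error X n f x\<bar> = \<bar>integral {-1..1} (\<lambda>t. g t * (tail_integral ^^ (r - 1)) h t)\<bar>"
    by (simp add: E_def m)
  also have "\<dots> \<le> 1 / sqrt c * (pi ^ r / (\<Prod>j=1..r. real n - real j)) * total_variation g (-1) 1"
    using n by (intro peano_integral_bound[OF h r _ gbv]) auto
  finally show ?thesis by simp
qed

theorem theorem4p2:
  fixes r n :: nat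
    and f :: "real \<Rightarrow> real"
    and D :: "nat \<Rightarrow> real \<Rightarrow> real"
    and X :: "nat \<Rightarrow> nat \<Rightarrow> real"
    and c :: real
  assumes "r \<ge> 1"
    and "derivatives_upto (r - 1) f D"
    and "abs_continuous (D (r - 1)) (-1) 1"
    and "bv_densities (D (r - 1)) \<noteq> {}"
    and "pointsystem X"
    and "strongly_normal X c"
    and "n \<ge> r + 1"
  shows "sup_norm (interp_error X n f)
           \<le> ereal (pi ^ r * min_density_variation (D (r - 1))
                    / (sqrt c * (\<Prod>j=1..r. real n - real j)))"
proof -
  define C where "C = pi ^ r / (sqrt c * (\<Prod>j=1..r. real n - real j))"
  have C: "C > 0"
    unfolding C_def using assms(6,7)
    by (auto simp: strongly_normal_def intro!: divide_pos_pos mult_pos_pos prod_pos)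
  have "\<bar>interp_error X n f x\<bar> \<le> C * min_density_variation (D (r - 1))" if x: "x \<in> {-1..1}" for x
  proof -
    \<comment> \<open>Dividing by \<open>C > 0\<close> leaves a lower bound independent of
      \<open>g\<close>, so it passes to the infimum over the nonempty set of densities.\<close>
    have "\<bar>interp_error X n f x\<bar> / C \<le> min_density_variation (D (r - 1))"
      unfolding min_density_variation_def
    proof (rule cINF_greatest[OF assms(4)])
      fix g assume "g \<in> bv_densities (D (r - 1))"
      then have "\<bar>interp_error X n f x\<bar> \<le> C * total_variation g (-1) 1"
        unfolding C_def by (rule interp_error_bound[OF assms(1,2) _ assms(5-7) x])
      then show "\<bar>interp_error X n f x\<bar> / C \<le> total_variation g (-1) 1"
        using C by (simp add: pos_divide_le_eq mult.commute)
    qed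
    then show ?thesis
      using C by (simp add: pos_divide_le_eq mult.commute)
  qed
  then have "sup_norm (interp_error X n f) \<le> ereal (C * min_density_variation (D (r - 1)))"
    unfolding sup_norm_def by (intro SUP_least) simp
  then show ?thesis
    by (simp add: C_def)
qed

end
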